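(* Let $\tilde\gamma$ be the rescaled curve shortening flow in $\mathbb{R}^3$, i.e. a family of closed curves $\tilde\gamma(\tau,\cdot):S^1\to\mathbb{R}^3$ satisfying $$\partial_\tau\tilde{\gamma}=\frac{1}{2}\tilde\gamma+\frac{\tilde\gamma'\times(\tilde\gamma''\times\tilde\gamma')}{|\tilde\gamma'|^4},$$ let $\lambda>0$, and let $\psi=\arcsin\frac{\langle\tilde\gamma,\tilde\gamma'\rangle}{|\tilde\gamma||\tilde\gamma'|}$. Then $$\frac{d}{d\tau}\int_{S^1}F_\lambda(\tilde\gamma,\tilde\gamma')\,dx=-\int_{S^1}\Big|\kappa+\frac{1}{2}\langle\tilde\gamma,\nu\rangle\Big|^2\rho_\lambda(\tilde\gamma,\tilde\gamma')\,dx-\int_{S^1}\left(\frac{1}{4}+(\lambda-1)\frac{\kappa^2}{|\tilde\gamma|^2\cos^2\psi}\right)\big|\mathrm{Proj}_{\nu\times\tilde\gamma'}\tilde\gamma\big|^2\rho_\lambda(\tilde\gamma,\tilde\gamma')\,dx,$$ where, with $\psi=\psi(\xi,\eta)=\arcsin\frac{\langle\xi,\eta\rangle}{|\xi||\eta|}$, $$F_\lambda(\xi,\eta)=a_\lambda(|\xi|)\,|\eta|\,f_\lambda(\psi),\qquad \rho_\lambda(\xi,\eta)=a_\lambda(|\xi|)\,|\eta|\,g_\lambda(\psi),$$ $$a_\lambda(r)=e^{-\frac{r^2}{4\lambda}}r^{\frac{1-\lambda}{\lambda}},\qquad g_\lambda(\psi)=\left(\frac{1}{\cos\psi}\right)^{\frac{\lambda-1}{\lambda}},$$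 $$f_\lambda(\psi)=\sin\psi\int_0^\psi(\cos t)^{\frac{1}{\lambda}}\,dt+\lambda(\cos\psi)^{1+\frac{1}{\lambda}}.$$
   Context: Let $\gamma:(0,T)\times S^1\to\mathbb{R}^3$ be a (smooth, regular) parametrized closed curve moving by curvature, $\partial_t\gamma=\kappa\nu$, whose first singularity appears at the point $0$ after finite time $T$. The rescaled flow is $\tau=-\log(T-t)$, $\tilde\gamma(\tau,x)=(T-t)^{-1/2}\gamma(t,x)$; it satisfies the equation displayed in the claim. The prime $'$ denotes the derivative in $x\in S^1$. For a curve, $\kappa=\frac{|\gamma''\times\gamma'|}{|\gamma'|^3}$ is the curvature and $\nu=\frac{\gamma'\times(\gamma''\times\gamma')}{|\gamma'||\gamma''\times\gamma'|}$ is the unit normal vector; in the claim $\kappa,\nu$ are those of $\tilde\gamma(\tau,\cdot)$. At points where $\kappa=0$, $\nu$ is understood as any (measurably chosen) unit vector orthogonal to $\tilde\gamma'$. $\mathrm{Proj}_w v$ denotes the orthogonal projection of $v$ onto the line spanned by $w$. It is understood that $\tilde\gamma\neq0$ so that the expressions are defined. *)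

theory Defs
  imports "HOL-Analysis.Analysis"
begin

(* Ck_on k S f is meant for open S; smooth_map_on S f is C^infinity on S. *)

primrec Ck_on ::
  "nat \<Rightarrow> 'a::real_normed_vector set \<Rightarrow> ('a \<Rightarrow> 'b::real_normed_vector) \<Rightarrow> bool" where
  "Ck_on 0 S f \<longleftrightarrow> continuous_on S f"
| "Ck_on (Suc k) S f \<longleftrightarrow>
     (\<forall>p\<in>S. f differentiable (at p)) \<and> (\<forall>v. Ck_on k S (\<lambda>p. frechet_derivative f (at p) v))"

definition smooth_map_on ::
  "'a::real_normed_vector set \<Rightarrow> ('a \<Rightarrow> 'b::real_normed_vector) \<Rightarrow> bool" where
  "smooth_map_on S f \<longleftrightarrow> (\<forall>k. Ck_on k S f)"

definition curve_d :: "(real \<Rightarrow> real^3) \<Rightarrow> real \<Rightarrow> real^3" where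
  "curve_d c x = vector_derivative c (at x)"

definition curve_dd :: "(real \<Rightarrow> real^3) \<Rightarrow> real \<Rightarrow> real^3" where
  "curve_dd c = curve_d (curve_d c)"

(* A curve parametrized by S^1 = R/(2 pi Z) is a 2 pi-periodic map on the real line.
   For t in (0,T) the rescaled time tau = - ln (T - t) ranges over {- ln T <..}. *)

definition rescaled_csf :: "real \<Rightarrow> (real \<Rightarrow> real \<Rightarrow> real^3) \<Rightarrow> bool" where
  "rescaled_csf T \<gamma> \<longleftrightarrow>
     smooth_map_on ({- ln T <..} \<times> UNIV) (\<lambda>(\<tau>, x). \<gamma> \<tau> x) \<and>
     (\<forall>\<tau>>- ln T. \<forall>x. \<gamma> \<tau> (x + 2 * pi) = \<gamma> \<tau> x) \<and>
     (\<forall>\<tau>>- ln T. \<forall>x. curve_d (\<gamma> \<tau>) x \<noteq> 0) \<and>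
     (\<forall>\<tau>>- ln T. \<forall>x.
        ((\<lambda>s. \<gamma> s x) has_vector_derivative
          (1 / 2) *\<^sub>R \<gamma> \<tau> x
          + (1 / norm (curve_d (\<gamma> \<tau>) x) ^ 4) *\<^sub>R
              cross3 (curve_d (\<gamma> \<tau>) x) (cross3 (curve_dd (\<gamma> \<tau>) x) (curve_d (\<gamma> \<tau>) x))) (at \<tau>))"

definition curvature :: "(real \<Rightarrow> real^3) \<Rightarrow> real \<Rightarrow> real" where
  "curvature c x = norm (cross3 (curve_dd c x) (curve_d c x)) / norm (curve_d c x) ^ 3"

(* Where the curvature vanishes the normal is not determined by the curve: any choice of a
   unit vector orthogonal to the tangent is admitted, as long as the whole field is measurable. *)

definition unit_normal_field :: "(real \<Rightarrow> real^3) \<Rightarrow> (real \<Rightarrow> real^3) \<Rightarrow> bool" where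
  "unit_normal_field c \<nu> \<longleftrightarrow>
     \<nu> \<in> borel_measurable (lebesgue_on {0..2*pi}) \<and>
     (\<forall>x\<in>{0..2*pi}.
        if curvature c x \<noteq> 0
        then \<nu> x = (1 / (norm (curve_d c x) * norm (cross3 (curve_dd c x) (curve_d c x)))) *\<^sub>R
                     cross3 (curve_d c x) (cross3 (curve_dd c x) (curve_d c x))
        else norm (\<nu> x) = 1 \<and> \<nu> x \<bullet> curve_d c x = 0)"

definition line_proj :: "real^3 \<Rightarrow> real^3 \<Rightarrow> real^3" where
  "line_proj w v = ((v \<bullet> w) / (w \<bullet> w)) *\<^sub>R w"

definition psi_angle :: "real^3 \<Rightarrow> real^3 \<Rightarrow> real" where
  "psi_angle \<xi> \<eta> = arcsin ((\<xi> \<bullet> \<eta>) / (norm \<xi> * norm \<eta>))"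

definition a_fun :: "real \<Rightarrow> real \<Rightarrow> real" where
  "a_fun lam r = exp (- (r\<^sup>2 / (4 * lam))) * r powr ((1 - lam) / lam)"

(* When cos psi = 0 this takes the value 0, by 1 / 0 = 0 and 0 powr _ = 0.  The position vector is
   then tangent to the curve; almost everywhere on that set the curvature vanishes too, so the
   factors multiplying rho_fun below are 0 there and the convention does not affect the integrals. *)

definition g_fun :: "real \<Rightarrow> real \<Rightarrow> real" where
  "g_fun lam \<psi> = (1 / cos \<psi>) powr ((lam - 1) / lam)"

(* The integral is oriented, since psi may be negative; hence LBINT with endpoints
   rather than an integral over the set {0..psi}. *)

definition f_fun :: "real \<Rightarrow> real \<Rightarrow> real" where
  "f_fun lam \<psi> = sin \<psi> * (LBINT t=ereal 0..ereal \<psi>. cos t powr (1 / lam))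
                + lam * cos \<psi> powr (1 + 1 / lam)"

definition F_fun :: "real \<Rightarrow> real^3 \<Rightarrow> real^3 \<Rightarrow> real" where
  "F_fun lam \<xi> \<eta> = a_fun lam (norm \<xi>) * norm \<eta> * f_fun lam (psi_angle \<xi> \<eta>)"

definition rho_fun :: "real \<Rightarrow> real^3 \<Rightarrow> real^3 \<Rightarrow> real" where
  "rho_fun lam \<xi> \<eta> = a_fun lam (norm \<xi>) * norm \<eta> * g_fun lam (psi_angle \<xi> \<eta>)"

definition normal_term :: "real \<Rightarrow> (real \<Rightarrow> real^3) \<Rightarrow> (real \<Rightarrow> real^3) \<Rightarrow> real \<Rightarrow> real" where
  "normal_term lam c \<nu> x =
     \<bar>curvature c x + 1 / 2 * (c x \<bullet> \<nu> x)\<bar>\<^sup>2 * rho_fun lam (c x) (curve_d c x)"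

definition binormal_term :: "real \<Rightarrow> (real \<Rightarrow> real^3) \<Rightarrow> (real \<Rightarrow> real^3) \<Rightarrow> real \<Rightarrow> real" where
  "binormal_term lam c \<nu> x =
     (1 / 4 + (lam - 1) * ((curvature c x)\<^sup>2
                / ((norm (c x))\<^sup>2 * (cos (psi_angle (c x) (curve_d c x)))\<^sup>2)))
     * (norm (line_proj (cross3 (\<nu> x) (curve_d c x)) (c x)))\<^sup>2
     * rho_fun lam (c x) (curve_d c x)"

end

theory Submission
  imports Defs
begin

text \<open>
  Write \<open>c\<close>, \<open>e = c'\<close> and \<open>X\<close> for the position, the tangent and the velocity of the curve at time
  \<open>\<tau>\<close>, and \<open>G = c \<times> e\<close>, so that \<open>cos \<psi> = |G| / (|c| |e|)\<close>. The formula is the first variation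
  formula for the length-like functional \<open>\<integral> F(c, e) dx\<close>: away from the tangency set
  \<open>{G = 0}\<close> it is an Euler-Lagrange computation, in which the equation \<open>f'' + f = g\<close> for the profile
  \<open>f\<close> makes the weight \<open>\<rho>\<close> appear. The difficulty is that for \<open>\<lambda> > 1\<close> the weight \<open>g\<close> blows up at
  \<open>\<psi> = \<plusminus>\<pi>/2\<close>, where the position is parallel to the tangent, and that a smooth curve can be tangent
  in this way on an arbitrary closed set. So \<open>F\<close> is only \<open>C\<^sup>1\<close>, and its gradient cannot
  be differentiated along the curve without care.

  \<^emph>\<open>\<open>F\<close> is \<open>C\<^sup>1\<close>.\<close> In terms of the radial speed \<open>u = |\<eta>| sin \<psi>\<close> and the transverse speed
  \<open>v = |\<eta>| cos \<psi>\<close> one has \<open>|\<eta>| f(\<psi>) = u I(\<psi>) + \<lambda> v C(\<psi>)\<close> with \<open>C = cos\<^sup>1\<^sup>/\<^sup>\<lambda>\<close> and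
  \<open>I = \<integral> C\<close>, and this is the largest of the linear functions \<open>u I(\<theta>) + \<lambda> v C(\<theta>)\<close>
  (\<open>support_function_bound\<close>). A maximum of linear functions with a unique
  maximiser that moves continuously is differentiable, with derivative that of the active function;
  this covers \<open>\<psi> = \<plusminus>\<pi>/2\<close> as well (\<open>F_fun_has_derivative_along\<close>). The resulting differential
  \<open>dF\<close> is continuous, so the integral may be differentiated under the integral sign.

  \<^emph>\<open>Reduction to the normal velocity.\<close> Because \<open>F\<close> is homogeneous of degree one in \<open>\<eta>\<close>, a tangential
  velocity \<open>\<phi> e\<close> contributes the total derivative of \<open>\<phi> F(c, e)\<close>, whose integral over the closed curve
  is zero. There remains \<open>Y = c\<^sup>\<perp>/2 + \<kappa>\<nu>\<close>.

  \<^emph>\<open>Integration by parts.\<close> The flux \<open>h = dF(0, Y)\<close>, the \<open>\<eta>\<close>-gradient of \<open>F\<close> paired with \<open>Y\<close>, is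
  continuous, vanishes on \<open>{G = 0}\<close>, and off this set \<open>h'\<close> is \<open>dF(Y, Y')\<close> plus the two integrands of
  the claim (\<open>normal_flux_derivative\<close>, \<open>variation_density_eq\<close>). A continuous function that
  vanishes on a closed set and has an integrable derivative elsewhere still satisfies the fundamental
  theorem of calculus (\<open>integral_derivative_off_zero_set\<close>), so that derivative has integral zero.

  \<^emph>\<open>Integrability.\<close> The only singular contribution is \<open>\<kappa>\<^sup>2 |G|\<^sup>p\<close> with \<open>p = 1/\<lambda> - 1 > -1\<close>. Where
  \<open>|G|\<close> is small, \<open>\<kappa>\<close> is controlled by \<open>|G'|\<close> (\<open>curvature_bound\<close>), and \<open>|G'|\<^sup>2 |G|\<^sup>p\<close> is integrable
  for every \<open>C\<^sup>2\<close> map \<open>G\<close> (\<open>integrable_weighted_derivative_square\<close>).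
\<close>

section \<open>The angular profile and its support function\<close>

definition cos_integral :: "real \<Rightarrow> real \<Rightarrow> real" where
  "cos_integral lam \<psi> = (LBINT t=ereal 0..ereal \<psi>. cos t powr (1 / lam))"

definition cos_root :: "real \<Rightarrow> real \<Rightarrow> real" where
  "cos_root lam \<psi> = cos \<psi> powr (1 / lam)"

lemma cos_nonneg_half_pi: "0 \<le> cos t" if "t \<in> {- (pi/2)..pi/2}" for t
  using that by (auto intro: cos_ge_zero)

lemma f_fun_eq:
  assumes "\<psi> \<in> {- (pi/2)..pi/2}"
  shows "f_fun lam \<psi> = sin \<psi> * cos_integral lam \<psi> + lam * cos \<psi> * cos_root lam \<psi>"
proof -
  have "cos \<psi> powr (1 + 1 / lam) = cos \<psi> * cos \<psi> powr (1 / lam)"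
    using cos_nonneg_half_pi[OF assms] by (cases "cos \<psi> = 0") (auto simp: powr_add)
  then show ?thesis by (simp add: f_fun_def cos_integral_def cos_root_def)
qed

lemma continuous_on_cos_root:
  assumes "0 < lam"
  shows "continuous_on {- (pi/2)..pi/2} (cos_root lam)"
  unfolding cos_root_def
  using assms by (intro continuous_on_powr' continuous_intros) (auto intro: cos_ge_zero)

lemma cos_integral_derivative:
  assumes "0 < lam" "\<psi> \<in> {- (pi/2)..pi/2}"
  shows "(cos_integral lam has_real_derivative cos_root lam \<psi>) (at \<psi> within {- (pi/2)..pi/2})"
  using interval_integral_FTC2[of "- (pi/2)" 0 "pi/2" "cos_root lam" \<psi>] assms
    continuous_on_cos_root[of lam]
  by (simp add: cos_integral_def[abs_def] cos_root_def[abs_def] has_real_derivative_iff_has_vector_derivative)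

lemma continuous_on_cos_integral:
  assumes "0 < lam"
  shows "continuous_on {- (pi/2)..pi/2} (cos_integral lam)"
  using cos_integral_derivative[OF assms] by (meson DERIV_continuous_on)

lemma cos_integral_derivative_interior:
  assumes "0 < lam" "\<bar>\<psi>\<bar> < pi/2"
  shows "(cos_integral lam has_real_derivative cos_root lam \<psi>) (at \<psi>)"
proof -
  have "at \<psi> within {- (pi/2)..pi/2} = at \<psi>"
    using assms by (intro at_within_interior) auto
  moreover have "\<psi> \<in> {- (pi/2)..pi/2}" using assms(2) by auto
  ultimately show ?thesis using cos_integral_derivative[OF assms(1)] by metis
qed

lemma cos_root_derivative:
  assumes "0 < lam" "\<bar>\<psi>\<bar> < pi/2"
  shows "(cos_root lam has_real_derivative - (1/lam) * cos_root lam \<psi> * tan \<psi>) (at \<psi>)"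
proof -
  have c: "cos \<psi> > 0" using assms by (intro cos_gt_zero_pi) auto
  have "((\<lambda>t. cos t powr (1/lam)) has_real_derivative
     (- (1/lam) * cos \<psi> powr (1/lam) * tan \<psi>)) (at \<psi>)"
    using c by (auto intro!: derivative_eq_intros simp: tan_def powr_diff field_simps)
  then show ?thesis by (simp add: cos_root_def[abs_def])
qed

text \<open>As a function of \<open>\<theta>\<close> the left-hand side has derivative \<open>cos\<^sup>1\<^sup>/\<^sup>\<lambda>\<^sup>-\<^sup>1 \<theta> sin (\<psi> - \<theta>)\<close>, so it increases
  up to \<open>\<theta> = \<psi>\<close> and decreases afterwards, and its maximum is \<open>f \<psi>\<close>. In other words \<open>f\<close> is the support
  function of the curve \<open>\<theta> \<mapsto> (I \<theta>, \<lambda> cos\<^sup>1\<^sup>/\<^sup>\<lambda> \<theta>)\<close>, which is what makes \<open>F\<close> differentiable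
  even at \<open>\<psi> = \<plusminus>\<pi>/2\<close>.\<close>

lemma support_function_bound:
  assumes lam: "0 < lam" and \<psi>: "\<psi> \<in> {- (pi/2)..pi/2}" and \<theta>: "\<theta> \<in> {- (pi/2)..pi/2}"
  shows "sin \<psi> * cos_integral lam \<theta> + lam * cos \<psi> * cos_root lam \<theta> \<le> f_fun lam \<psi>"
proof -
  define q where "q = (\<lambda>\<theta>. sin \<psi> * cos_integral lam \<theta> + lam * cos \<psi> * cos_root lam \<theta>)"
  have cont: "continuous_on {- (pi/2)..pi/2} q"
    unfolding q_def
    by (intro continuous_intros continuous_on_cos_root continuous_on_cos_integral lam)
  have der: "(q has_real_derivative cos_root lam t / cos t * sin (\<psi> - t)) (at t)"
    if "\<bar>t\<bar> < pi/2" for t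
  proof -
    have c: "cos t > 0" using that by (intro cos_gt_zero_pi) auto
    show ?thesis unfolding q_def
      using c lam
      by (auto intro!: derivative_eq_intros cos_root_derivative[OF lam that]
            cos_integral_derivative_interior[OF lam that]
          simp: sin_diff tan_def field_simps)
  qed
  have cpos: "0 \<le> cos_root lam t / cos t" if "\<bar>t\<bar> < pi/2" for t
    using that by (auto simp: cos_root_def intro!: divide_nonneg_nonneg cos_ge_zero)
  have "q \<theta> \<le> q \<psi>"
  proof (cases "\<theta> \<le> \<psi>")
    case True
    show ?thesis
    proof (rule DERIV_nonneg_imp_increasing_open[OF True])
      fix t assume t: "\<theta> < t" "t < \<psi>"
      then have b: "\<bar>t\<bar> < pi/2" using \<psi> \<theta> by auto
      moreover have "0 \<le> sin (\<psi> - t)" using t \<psi> \<theta> by (intro sin_ge_zero) auto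
      ultimately show "\<exists>y. (q has_real_derivative y) (at t) \<and> 0 \<le> y"
        using der[OF b] cpos[OF b] mult_nonneg_nonneg by blast
    qed (rule continuous_on_subset[OF cont], use \<psi> \<theta> in auto)
  next
    case False
    then have le: "\<psi> \<le> \<theta>" by simp
    have "- q \<psi> \<le> - q \<theta>"
    proof (rule DERIV_nonneg_imp_increasing_open[OF le])
      fix t assume t: "\<psi> < t" "t < \<theta>"
      then have b: "\<bar>t\<bar> < pi/2" using \<psi> \<theta> by auto
      have "0 \<le> sin (t - \<psi>)" using t \<psi> \<theta> by (intro sin_ge_zero) auto
      then have "cos_root lam t / cos t * sin (\<psi> - t) \<le> 0"
        using cpos[OF b] by (intro mult_nonneg_nonpos) (auto simp: sin_diff mult.commute)
      then show "\<exists>y. ((\<lambda>x. - q x) has_real_derivative y) (at t) \<and> 0 \<le> y"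
        using DERIV_minus[OF der[OF b]] by (metis neg_0_le_iff_le)
    qed (intro continuous_intros continuous_on_subset[OF cont], use \<psi> \<theta> in auto)
    then show ?thesis by simp
  qed
  then show ?thesis by (simp add: q_def f_fun_eq[OF \<psi>])
qed

lemma sine_psi_angle_bounds:
  fixes \<xi> \<eta> :: "real^3"
  shows "- 1 \<le> (\<xi> \<bullet> \<eta>) / (norm \<xi> * norm \<eta>)" "(\<xi> \<bullet> \<eta>) / (norm \<xi> * norm \<eta>) \<le> 1"
proof -
  have "\<bar>(\<xi> \<bullet> \<eta>) / (norm \<xi> * norm \<eta>)\<bar> \<le> 1"
    using Cauchy_Schwarz_ineq2[of \<xi> \<eta>]
    by (cases "norm \<xi> * norm \<eta> = 0") (auto simp: divide_simps abs_mult)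
  then show "- 1 \<le> (\<xi> \<bullet> \<eta>) / (norm \<xi> * norm \<eta>)" "(\<xi> \<bullet> \<eta>) / (norm \<xi> * norm \<eta>) \<le> 1"
    unfolding abs_le_iff by linarith+
qed

lemma psi_angle_range: "psi_angle \<xi> \<eta> \<in> {- (pi/2)..pi/2}"
  using arcsin_bounded[OF sine_psi_angle_bounds] by (simp add: psi_angle_def)

lemma sin_psi_angle: "sin (psi_angle \<xi> \<eta>) = (\<xi> \<bullet> \<eta>) / (norm \<xi> * norm \<eta>)"
  using sin_arcsin[OF sine_psi_angle_bounds] by (simp add: psi_angle_def)

lemma cos_psi_angle:
  assumes "\<xi> \<noteq> 0" "\<eta> \<noteq> 0"
  shows "cos (psi_angle \<xi> \<eta>) = norm (cross3 \<xi> \<eta>) / (norm \<xi> * norm \<eta>)"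
proof (rule power2_eq_imp_eq)
  have "(cos (psi_angle \<xi> \<eta>))\<^sup>2 = 1 - ((\<xi> \<bullet> \<eta>) / (norm \<xi> * norm \<eta>))\<^sup>2"
    using sin_cos_squared_add[of "psi_angle \<xi> \<eta>"] by (simp add: sin_psi_angle)
  also have "\<dots> = (norm (cross3 \<xi> \<eta>) / (norm \<xi> * norm \<eta>))\<^sup>2"
    using assms norm_cross[of \<xi> \<eta>] by (simp add: power_divide power_mult_distrib diff_divide_distrib)
  finally show "(cos (psi_angle \<xi> \<eta>))\<^sup>2 = (norm (cross3 \<xi> \<eta>) / (norm \<xi> * norm \<eta>))\<^sup>2" .
qed (use cos_nonneg_half_pi[OF psi_angle_range] in auto)

lemma psi_angle_interior:
  assumes "\<xi> \<noteq> 0" "\<eta> \<noteq> 0" "cross3 \<xi> \<eta> \<noteq> 0"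
  shows "\<bar>psi_angle \<xi> \<eta>\<bar> < pi/2"
proof -
  have "cos (psi_angle \<xi> \<eta>) > 0" using assms by (simp add: cos_psi_angle)
  then have "psi_angle \<xi> \<eta> \<noteq> pi/2" "psi_angle \<xi> \<eta> \<noteq> - (pi/2)" by (metis cos_pi_half cos_minus less_irrefl)+
  then show ?thesis using psi_angle_range[of \<xi> \<eta>] unfolding abs_less_iff by auto
qed

lemma continuous_on_psi_angle:
  assumes "continuous_on S c" "continuous_on S e" "\<And>p. p \<in> S \<Longrightarrow> c p \<noteq> 0" "\<And>p. p \<in> S \<Longrightarrow> e p \<noteq> 0"
  shows "continuous_on S (\<lambda>p. psi_angle (c p) (e p))"
proof -
  have "continuous_on S (\<lambda>p. (c p \<bullet> e p) / (norm (c p) * norm (e p)))"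
    using assms by (intro continuous_intros) auto
  then show ?thesis unfolding psi_angle_def
    by (rule continuous_on_arcsin) (use sine_psi_angle_bounds in blast)
qed

text \<open>The radial speed is \<open>\<langle>\<xi>, \<eta>\<rangle> / |\<xi>| = |\<eta>| sin \<psi>\<close> and the transverse speed is
  \<open>|\<xi> \<times> \<eta>| / |\<xi>| = |\<eta>| cos \<psi>\<close>; these are their variations when \<open>\<xi>\<close> and \<open>\<eta>\<close> move with velocities \<open>X\<close>
  and \<open>Z\<close>.\<close>

definition d_radial_speed :: "real^3 \<Rightarrow> real^3 \<Rightarrow> real^3 \<Rightarrow> real^3 \<Rightarrow> real" where
  "d_radial_speed \<xi> \<eta> X Z = (X \<bullet> \<eta> + \<xi> \<bullet> Z) / norm \<xi> - (\<xi> \<bullet> \<eta>) * (\<xi> \<bullet> X) / norm \<xi> ^ 3"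

text \<open>The transverse speed is not differentiable where \<open>\<xi> \<times> \<eta> = 0\<close>. The value given there by division
  by zero is harmless because this expression only occurs multiplied by \<open>cos\<^sup>1\<^sup>/\<^sup>\<lambda> \<psi>\<close>, which then vanishes.\<close>

definition d_transverse_speed :: "real^3 \<Rightarrow> real^3 \<Rightarrow> real^3 \<Rightarrow> real^3 \<Rightarrow> real" where
  "d_transverse_speed \<xi> \<eta> X Z =
     (cross3 \<xi> \<eta> \<bullet> (cross3 X \<eta> + cross3 \<xi> Z)) / norm (cross3 \<xi> \<eta>) / norm \<xi>
     - norm (cross3 \<xi> \<eta>) * (\<xi> \<bullet> X) / norm \<xi> ^ 3"

text \<open>This is \<open>a'(r) / (r a(r))\<close>. With the factor \<open>1/r\<close> it is the coefficient of \<open>\<langle>\<xi>, X\<rangle>\<close> in the variation of \<open>log a(|\<xi>|)\<close>.\<close>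

definition dlog_a :: "real \<Rightarrow> real \<Rightarrow> real" where
  "dlog_a lam r = - 1 / (2 * lam) + (1 - lam) / (lam * r\<^sup>2)"

text \<open>The differential of \<open>F\<close> at \<open>(\<xi>, \<eta>)\<close> in the direction \<open>(X, Z)\<close>. The angle itself is not varied: since \<open>f\<close>
  is a maximum over angles, the derivative with respect to the maximiser drops out.\<close>

definition dF :: "real \<Rightarrow> real^3 \<Rightarrow> real^3 \<Rightarrow> real^3 \<Rightarrow> real^3 \<Rightarrow> real" where
  "dF lam \<xi> \<eta> X Z = a_fun lam (norm \<xi>) *
     (dlog_a lam (norm \<xi>) * (\<xi> \<bullet> X) * (norm \<eta> * f_fun lam (psi_angle \<xi> \<eta>))
      + cos_integral lam (psi_angle \<xi> \<eta>) * d_radial_speed \<xi> \<eta> X Z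
      + lam * (cos_root lam (psi_angle \<xi> \<eta>) * d_transverse_speed \<xi> \<eta> X Z))"

text \<open>The unit vector \<open>G / |G|\<close> jumps at the zeros of \<open>G\<close>, but it is bounded and \<open>C\<close> vanishes there.\<close>

lemma continuous_on_unit_factor:
  fixes C :: "'a::topological_space \<Rightarrow> real" and G H :: "'a \<Rightarrow> 'b::real_inner"
  assumes C: "continuous_on S C" and G: "continuous_on S G" and H: "continuous_on S H"
    and zero: "\<And>p. p \<in> S \<Longrightarrow> G p = 0 \<Longrightarrow> C p = 0"
  shows "continuous_on S (\<lambda>p. C p * ((G p \<bullet> H p) / norm (G p)))"
  unfolding continuous_on_def
proof
  fix p assume p: "p \<in> S"
  have lim: "(C \<longlongrightarrow> C p) (at p within S)" "(G \<longlongrightarrow> G p) (at p within S)" "(H \<longlongrightarrow> H p) (at p within S)"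
    using C G H p by (auto simp: continuous_on_def)
  show "((\<lambda>p. C p * ((G p \<bullet> H p) / norm (G p))) \<longlongrightarrow> C p * ((G p \<bullet> H p) / norm (G p))) (at p within S)"
  proof (cases "G p = 0")
    case False
    then show ?thesis by (intro tendsto_intros lim) auto
  next
    case True
    have "((\<lambda>p. \<bar>C p\<bar> * norm (H p)) \<longlongrightarrow> \<bar>C p\<bar> * norm (H p)) (at p within S)"
      by (intro tendsto_intros lim)
    then have z: "((\<lambda>p. \<bar>C p\<bar> * norm (H p)) \<longlongrightarrow> 0) (at p within S)"
      using zero[OF p True] by simp
    have "norm (C q * ((G q \<bullet> H q) / norm (G q))) \<le> \<bar>C q\<bar> * norm (H q)" for q
    proof -
      have "\<bar>G q \<bullet> H q\<bar> / norm (G q) \<le> norm (H q)"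
        using Cauchy_Schwarz_ineq2[of "G q" "H q"] by (cases "G q = 0") (auto simp: divide_simps mult.commute)
      then show ?thesis
        using mult_left_mono[of "\<bar>G q \<bullet> H q\<bar> / norm (G q)" "norm (H q)" "\<bar>C q\<bar>"]
        by (simp add: abs_mult)
    qed
    then have "((\<lambda>q. C q * ((G q \<bullet> H q) / norm (G q))) \<longlongrightarrow> 0) (at p within S)"
      by (intro Lim_null_comparison[OF _ z] always_eventually allI)
    then show ?thesis using zero[OF p True] by simp
  qed
qed

lemma cos_root_psi_eq_0:
  assumes "\<xi> \<noteq> 0" "\<eta> \<noteq> 0" "cross3 \<xi> \<eta> = 0"
  shows "cos_root lam (psi_angle \<xi> \<eta>) = 0"
  using assms by (simp add: cos_root_def cos_psi_angle)

lemma continuous_on_a_fun: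
  assumes "continuous_on S c" "\<And>p. p \<in> S \<Longrightarrow> c p \<noteq> (0::real^3)"
  shows "continuous_on S (\<lambda>p. a_fun lam (norm (c p)))"
  unfolding a_fun_def using assms by (cases "lam = 0") (auto intro!: continuous_intros)

lemma angular_part_eq:
  assumes "\<xi> \<noteq> 0" "\<eta> \<noteq> 0"
  shows "norm \<eta> * f_fun lam (psi_angle \<xi> \<eta>) =
     (\<xi> \<bullet> \<eta>) / norm \<xi> * cos_integral lam (psi_angle \<xi> \<eta>)
     + lam * (norm (cross3 \<xi> \<eta>) / norm \<xi>) * cos_root lam (psi_angle \<xi> \<eta>)"
  using assms
  by (simp add: f_fun_eq[OF psi_angle_range] sin_psi_angle cos_psi_angle field_simps)

context
  fixes lam :: real and S :: "'a::t2_space set" and c e :: "'a \<Rightarrow> real^3"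
  assumes lam: "0 < lam" and c: "continuous_on S c" and e: "continuous_on S e"
    and c0: "\<And>p. p \<in> S \<Longrightarrow> c p \<noteq> 0" and e0: "\<And>p. p \<in> S \<Longrightarrow> e p \<noteq> 0"
begin

lemma continuous_on_cos_integral_psi: "continuous_on S (\<lambda>p. cos_integral lam (psi_angle (c p) (e p)))"
  by (rule continuous_on_compose2[OF continuous_on_cos_integral[OF lam] continuous_on_psi_angle])
     (use c e c0 e0 psi_angle_range in auto)

lemma continuous_on_cos_root_psi: "continuous_on S (\<lambda>p. cos_root lam (psi_angle (c p) (e p)))"
  by (rule continuous_on_compose2[OF continuous_on_cos_root[OF lam] continuous_on_psi_angle])
     (use c e c0 e0 psi_angle_range in auto)

lemma continuous_on_angular_part: "continuous_on S (\<lambda>p. norm (e p) * f_fun lam (psi_angle (c p) (e p)))"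
proof -
  have "continuous_on S (\<lambda>p. (c p \<bullet> e p) / norm (c p) * cos_integral lam (psi_angle (c p) (e p))
     + lam * (norm (cross3 (c p) (e p)) / norm (c p)) * cos_root lam (psi_angle (c p) (e p)))"
    using c0 by (intro continuous_intros continuous_on_cos_integral_psi continuous_on_cos_root_psi
         continuous_on_cross c e) auto
  then show ?thesis
    by (rule continuous_on_eq) (simp add: angular_part_eq c0 e0)
qed

lemma continuous_on_F_fun: "continuous_on S (\<lambda>p. F_fun lam (c p) (e p))"
  using continuous_on_mult[OF continuous_on_a_fun[OF c c0] continuous_on_angular_part]
  by (simp add: F_fun_def mult.assoc)

lemma continuous_on_dF:
  assumes X: "continuous_on S X" and Z: "continuous_on S Z"
  shows "continuous_on S (\<lambda>p. dF lam (c p) (e p) (X p) (Z p))"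
proof -
  let ?C = "\<lambda>p. cos_root lam (psi_angle (c p) (e p))"
  let ?G = "\<lambda>p. cross3 (c p) (e p)" and ?H = "\<lambda>p. cross3 (X p) (e p) + cross3 (c p) (Z p)"
  have "continuous_on S (\<lambda>p. ?C p * ((?G p \<bullet> ?H p) / norm (?G p)) / norm (c p)
      - ?C p * norm (?G p) * (c p \<bullet> X p) / norm (c p) ^ 3)"
    using c0 cos_root_psi_eq_0[OF c0 e0]
    by (intro continuous_intros continuous_on_unit_factor continuous_on_cos_root_psi
        continuous_on_cross c e X Z) auto
  then have C: "continuous_on S (\<lambda>p. ?C p * d_transverse_speed (c p) (e p) (X p) (Z p))"
    by (simp add: d_transverse_speed_def algebra_simps)
  have S: "continuous_on S (\<lambda>p. d_radial_speed (c p) (e p) (X p) (Z p))"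
    unfolding d_radial_speed_def using c0 by (intro continuous_intros c e X Z) auto
  have A: "continuous_on S (\<lambda>p. dlog_a lam (norm (c p)))"
    unfolding dlog_a_def using c0 lam by (intro continuous_intros c) auto
  show ?thesis
    unfolding dF_def
    by (intro continuous_on_mult continuous_on_add continuous_on_inner C S A
        continuous_on_cos_integral_psi continuous_on_angular_part continuous_on_a_fun c c0 X
        continuous_on_const)
qed

end

section \<open>The differential of F along curves\<close>

lemma norm_has_real_derivative:
  fixes f :: "real \<Rightarrow> 'a::real_inner"
  assumes "(f has_vector_derivative f') (at t)" "f t \<noteq> 0"
  shows "((\<lambda>s. norm (f s)) has_real_derivative (f t \<bullet> f') / norm (f t)) (at t)"
proof -
  have "((\<lambda>s. norm (f s)) has_derivative (\<lambda>h. (h *\<^sub>R f') \<bullet> sgn (f t))) (at t)"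
    using has_derivative_compose[OF assms(1)[unfolded has_vector_derivative_def] has_derivative_norm[OF assms(2)]]
    by simp
  then show ?thesis
    unfolding has_field_derivative_def
    by (rule has_derivative_eq_rhs) (auto simp: sgn_div_norm inner_commute divide_inverse algebra_simps)
qed

lemma inner_has_real_derivative:
  fixes f g :: "real \<Rightarrow> 'a::real_inner"
  assumes "(f has_vector_derivative f') (at t)" "(g has_vector_derivative g') (at t)"
  shows "((\<lambda>s. f s \<bullet> g s) has_real_derivative f t \<bullet> g' + f' \<bullet> g t) (at t)"
  using bounded_bilinear.has_vector_derivative[OF bounded_bilinear_inner assms]
  by (simp add: has_real_derivative_iff_has_vector_derivative)

lemma bounded_bilinear_cross3: "bounded_bilinear cross3"
  using bilinear_cross bilinear_conv_bounded_bilinear by blast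

lemmas cross3_has_vector_derivative = bounded_bilinear.has_vector_derivative[OF bounded_bilinear_cross3]

text \<open>The derivative of a maximum of functions. Here \<open>R\<close> is the excess of \<open>u I + \<lambda> |G| C\<close> over the member
  of the family that is maximal at time \<open>t\<close>. Optimality at time \<open>s\<close> gives \<open>0 \<le> R s\<close>, and optimality at
  time \<open>t\<close> gives the upper bound, a product of an \<open>O(s - t)\<close> and an \<open>o(1)\<close> term. The transverse
  speed enters as the norm of a differentiable vector, which is Lipschitz at \<open>t\<close> even if
  it is zero there.\<close>

lemma angular_part_touching:
  fixes u v I C :: "real \<Rightarrow> real" and G :: "real \<Rightarrow> 'a::real_normed_vector"
  assumes lam: "0 \<le> lam"
    and u: "(u has_real_derivative u') (at t)" and G: "(G has_vector_derivative G') (at t)"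
    and I: "isCont I t" and C: "isCont C t"
    and lower: "\<forall>\<^sub>F s in at t. 0 \<le> R s"
    and upper: "\<forall>\<^sub>F s in at t. R s \<le> (u s - u t) * (I s - I t) + lam * ((norm (G s) - norm (G t)) * (C s - C t))"
    and R0: "R t = 0"
  shows "(R has_real_derivative 0) (at t)"
  unfolding has_field_derivative_iff
proof (rule Lim_null_comparison)
  let ?b = "\<lambda>s. \<bar>(u s - u t) / (s - t)\<bar> * \<bar>I s - I t\<bar> + lam * (norm ((G s - G t) /\<^sub>R (s - t)) * \<bar>C s - C t\<bar>)"
  have q: "((\<lambda>s. (G s - G t) /\<^sub>R (s - t)) \<longlongrightarrow> G') (at t)"
  proof (rule Lim_transform[OF tendsto_const])
    have "((\<lambda>s. norm (G s - G t - (s - t) *\<^sub>R G') / norm (s - t)) \<longlongrightarrow> 0) (at t)"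
      using G by (simp add: has_vector_derivative_def has_derivative_iff_norm)
    moreover have "\<forall>\<^sub>F s in at t. norm (G s - G t - (s - t) *\<^sub>R G') / norm (s - t)
        = norm ((G s - G t) /\<^sub>R (s - t) - G')"
    proof (rule eventually_mono[OF eventually_neq_at_within[of t]])
      fix s assume "s \<noteq> t"
      then have "(G s - G t) /\<^sub>R (s - t) - G' = (G s - G t - (s - t) *\<^sub>R G') /\<^sub>R (s - t)"
        by (simp add: scaleR_diff_right)
      then show "norm (G s - G t - (s - t) *\<^sub>R G') / norm (s - t) = norm ((G s - G t) /\<^sub>R (s - t) - G')"
        by (simp add: divide_inverse mult.commute)
    qed
    ultimately have "((\<lambda>s. norm ((G s - G t) /\<^sub>R (s - t) - G')) \<longlongrightarrow> 0) (at t)"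
      by (rule Lim_transform_eventually)
    then show "((\<lambda>s. (G s - G t) /\<^sub>R (s - t) - G') \<longlongrightarrow> 0) (at t)"
      by (rule tendsto_norm_zero_cancel)
  qed
  have "(?b \<longlongrightarrow> \<bar>u'\<bar> * \<bar>I t - I t\<bar> + lam * (norm G' * \<bar>C t - C t\<bar>)) (at t)"
    using u I C unfolding has_field_derivative_iff isCont_def by (intro tendsto_intros q)
  then show "(?b \<longlongrightarrow> 0) (at t)" by simp
  show "\<forall>\<^sub>F s in at t. norm ((R s - R t) / (s - t)) \<le> ?b s"
    using lower upper
  proof eventually_elim
    case (elim s)
    have "(norm (G s) - norm (G t)) * (C s - C t) \<le> norm (G s - G t) * \<bar>C s - C t\<bar>"
      using mult_mono[OF norm_triangle_ineq3[of "G s" "G t"] order_refl[of "\<bar>C s - C t\<bar>"]]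
        abs_ge_self[of "(norm (G s) - norm (G t)) * (C s - C t)"] by (simp add: abs_mult)
    moreover have "(u s - u t) * (I s - I t) \<le> \<bar>u s - u t\<bar> * \<bar>I s - I t\<bar>"
      using abs_ge_self[of "(u s - u t) * (I s - I t)"] by (simp add: abs_mult)
    ultimately have "R s \<le> \<bar>u s - u t\<bar> * \<bar>I s - I t\<bar> + lam * (norm (G s - G t) * \<bar>C s - C t\<bar>)"
      using elim mult_left_mono[OF _ lam] by smt
    then have "R s / \<bar>s - t\<bar> \<le> (\<bar>u s - u t\<bar> * \<bar>I s - I t\<bar> + lam * (norm (G s - G t) * \<bar>C s - C t\<bar>)) / \<bar>s - t\<bar>"
      by (rule divide_right_mono) simp
    moreover have "norm ((R s - R t) / (s - t)) = R s / \<bar>s - t\<bar>"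
      using elim by (simp add: R0 abs_divide)
    moreover have "norm ((G s - G t) /\<^sub>R (s - t)) = norm (G s - G t) / \<bar>s - t\<bar>"
      by (simp add: divide_inverse mult.commute)
    ultimately show ?case by (simp only: abs_divide add_divide_distrib) (simp add: mult.commute)
  qed
qed

lemma a_fun_derivative:
  assumes "0 < lam" "0 < r"
  shows "(a_fun lam has_real_derivative a_fun lam r * (dlog_a lam r * r)) (at r)"
proof -
  define k where "k = (1 - lam) / lam"
  have *: "r powr (k - 1) = r powr k / r"
    using assms by (simp add: powr_diff)
  have "((\<lambda>r. exp (- (r\<^sup>2 / (4 * lam))) * r powr k) has_real_derivative
      exp (- (r\<^sup>2 / (4 * lam))) * r powr k * ((- 1 / (2 * lam) + k / r\<^sup>2) * r)) (at r)"
    using assms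
    by (auto intro!: derivative_eq_intros has_real_derivative_powr simp: * power2_eq_square field_simps)
  then show ?thesis
    using assms unfolding a_fun_def[abs_def] dlog_a_def k_def by simp
qed

text \<open>After subtraction of the excess \<open>R\<close>, whose derivative is zero, the angular part is a
  linear combination of \<open>u\<close> and \<open>|G|\<close> with coefficients fixed at time \<open>t\<close>. Where \<open>|G|\<close> is not
  differentiable its coefficient \<open>cos\<^sup>1\<^sup>/\<^sup>\<lambda> \<psi>\<close> is zero.\<close>

lemma F_fun_has_derivative_along:
  fixes c e :: "real \<Rightarrow> real^3"
  assumes lam: "0 < lam"
    and c: "(c has_vector_derivative X) (at t)" and e: "(e has_vector_derivative Z) (at t)"
    and c0: "c t \<noteq> 0" and e0: "e t \<noteq> 0"
  shows "((\<lambda>s. F_fun lam (c s) (e s)) has_real_derivative dF lam (c t) (e t) X Z) (at t)"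
proof -
  define u where "u = (\<lambda>s. (c s \<bullet> e s) / norm (c s))"
  define G where "G = (\<lambda>s. cross3 (c s) (e s) /\<^sub>R norm (c s))"
  define \<psi> where "\<psi> = (\<lambda>s. psi_angle (c s) (e s))"
  define I where "I = (\<lambda>s. cos_integral lam (\<psi> s))"
  define C where "C = (\<lambda>s. cos_root lam (\<psi> s))"
  define \<Phi> where "\<Phi> = (\<lambda>s. norm (e s) * f_fun lam (\<psi> s))"
  define R where "R = (\<lambda>s. \<Phi> s - (I t * u s + lam * (C t * norm (G s))))"
  have r: "((\<lambda>s. norm (c s)) has_real_derivative (c t \<bullet> X) / norm (c t)) (at t)"
    by (rule norm_has_real_derivative[OF c c0])
  have cr: "((\<lambda>s. cross3 (c s) (e s)) has_vector_derivative cross3 (c t) Z + cross3 X (e t)) (at t)"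
    by (rule cross3_has_vector_derivative[OF c e])
  have u': "(u has_real_derivative d_radial_speed (c t) (e t) X Z) (at t)"
    unfolding u_def
    by (rule DERIV_cong[OF DERIV_divide[OF inner_has_real_derivative[OF c e] r]])
       (use c0 in \<open>simp_all add: d_radial_speed_def divide_simps, simp add: power3_eq_cube algebra_simps\<close>)
  have "\<exists>y. (G has_vector_derivative y) (at t)"
    unfolding G_def
    by (rule exI, rule has_vector_derivative_scaleR[OF DERIV_inverse_fun[OF r] cr]) (simp add: c0)
  then obtain G' where G': "(G has_vector_derivative G') (at t)"
    by blast
  have near: "\<forall>\<^sub>F s in nhds t. c s \<noteq> 0 \<and> e s \<noteq> 0"
    using tendsto_imp_eventually_ne[OF has_vector_derivative_continuous[OF c, unfolded isCont_def] c0]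
      tendsto_imp_eventually_ne[OF has_vector_derivative_continuous[OF e, unfolded isCont_def] e0] c0 e0
    by (simp add: eventually_nhds_conv_at eventually_conj)
  then have near': "\<forall>\<^sub>F s in at t. c s \<noteq> 0 \<and> e s \<noteq> 0"
    by (simp add: eventually_nhds_conv_at)
  have us: "u s = norm (e s) * sin (\<psi> s)" and vs: "norm (G s) = norm (e s) * cos (\<psi> s)"
    if "c s \<noteq> 0 \<and> e s \<noteq> 0" for s
    using that by (auto simp: u_def G_def \<psi>_def sin_psi_angle cos_psi_angle field_simps)
  have \<Phi>s: "\<Phi> s = u s * I s + lam * (norm (G s) * C s)" if "c s \<noteq> 0 \<and> e s \<noteq> 0" for s
    using f_fun_eq[OF psi_angle_range, of lam "c s" "e s"]
    by (simp add: \<Phi>_def us[OF that] vs[OF that] I_def C_def \<psi>_def algebra_simps)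
  have ge: "u s * I q + lam * (norm (G s) * C q) \<le> \<Phi> s" if "c s \<noteq> 0 \<and> e s \<noteq> 0" for s q
    using mult_left_mono[OF support_function_bound[OF lam psi_angle_range psi_angle_range, of "c s" "e s" "c q" "e q"] norm_ge_zero[of "e s"]]
    by (simp add: \<Phi>_def us[OF that] vs[OF that] I_def C_def \<psi>_def algebra_simps)
  have t0: "c t \<noteq> 0 \<and> e t \<noteq> 0" using c0 e0 by simp
  obtain W where W: "open W" "t \<in> W" "\<And>s. s \<in> W \<Longrightarrow> c s \<noteq> 0 \<and> e s \<noteq> 0"
    using near unfolding eventually_nhds by blast
  have \<psi>c: "isCont \<psi> t"
  proof -
    have q: "isCont (\<lambda>s. (c s \<bullet> e s) / (norm (c s) * norm (e s))) t"
      using has_vector_derivative_continuous[OF c] has_vector_derivative_continuous[OF e] c0 e0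
      by (intro continuous_intros) auto
    have "continuous (at t) (\<lambda>s. arcsin ((c s \<bullet> e s) / (norm (c s) * norm (e s))))"
      unfolding isCont_def
      by (rule continuous_on_tendsto_compose[OF continuous_on_arcsin' q[unfolded isCont_def]])
         (use sine_psi_angle_bounds in \<open>auto intro!: always_eventually\<close>)
    then show ?thesis by (simp add: \<psi>_def psi_angle_def)
  qed
  have comp: "isCont (\<lambda>s. k (\<psi> s)) t" if "continuous_on {- (pi/2)..pi/2} k" for k :: "real \<Rightarrow> real"
    unfolding isCont_def
    by (rule continuous_on_tendsto_compose[OF that \<psi>c[unfolded isCont_def]])
       (use psi_angle_range in \<open>auto simp: \<psi>_def intro!: always_eventually\<close>)
  have Ic: "isCont I t" and Cc: "isCont C t"
    unfolding I_def C_def by (intro comp continuous_on_cos_integral continuous_on_cos_root lam)+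
  have R': "(R has_real_derivative 0) (at t)"
  proof (rule angular_part_touching[OF _ u' G' Ic Cc])
    show "\<forall>\<^sub>F s in at t. 0 \<le> R s"
      using near' by eventually_elim (use ge[of _ t] in \<open>auto simp: R_def algebra_simps\<close>)
    show "\<forall>\<^sub>F s in at t. R s \<le> (u s - u t) * (I s - I t) + lam * ((norm (G s) - norm (G t)) * (C s - C t))"
      using near'
    proof eventually_elim
      case (elim s)
      show ?case using ge[OF t0, of s] \<Phi>s[OF elim] \<Phi>s[OF t0] by (simp add: R_def algebra_simps)
    qed
    show "R t = 0" using \<Phi>s[OF t0] by (simp add: R_def algebra_simps)
  qed (use lam in simp)
  have v': "((\<lambda>s. C t * norm (G s)) has_real_derivative C t * d_transverse_speed (c t) (e t) X Z) (at t)"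
  proof (cases "cross3 (c t) (e t) = 0")
    case True
    then have "C t = 0" using cos_root_psi_eq_0[OF c0 e0 True] by (simp add: C_def \<psi>_def)
    then show ?thesis by simp
  next
    case False
    have "((\<lambda>s. norm (cross3 (c s) (e s)) / norm (c s)) has_real_derivative d_transverse_speed (c t) (e t) X Z) (at t)"
      by (rule DERIV_cong[OF DERIV_divide[OF norm_has_real_derivative[OF cr False] r]])
         (use c0 False in \<open>simp_all add: d_transverse_speed_def divide_simps, simp add: power3_eq_cube algebra_simps\<close>)
    then have "((\<lambda>s. norm (G s)) has_real_derivative d_transverse_speed (c t) (e t) X Z) (at t)"
      by (simp add: G_def divide_inverse mult.commute)
    then show ?thesis by (rule DERIV_cmult)
  qed
  have "((\<lambda>s. R s + (I t * u s + lam * (C t * norm (G s)))) has_real_derivative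
      0 + (I t * d_radial_speed (c t) (e t) X Z + lam * (C t * d_transverse_speed (c t) (e t) X Z))) (at t)"
    by (intro DERIV_add R' DERIV_cmult u' v')
  then have \<Phi>': "(\<Phi> has_real_derivative
      I t * d_radial_speed (c t) (e t) X Z + lam * (C t * d_transverse_speed (c t) (e t) X Z)) (at t)"
    by (simp add: R_def)
  have a': "((\<lambda>s. a_fun lam (norm (c s))) has_real_derivative
      a_fun lam (norm (c t)) * (dlog_a lam (norm (c t)) * norm (c t)) * ((c t \<bullet> X) / norm (c t))) (at t)"
    by (rule DERIV_chain2[OF a_fun_derivative r]) (use lam c0 in auto)
  have "((\<lambda>s. a_fun lam (norm (c s)) * \<Phi> s) has_real_derivative dF lam (c t) (e t) X Z) (at t)"
    by (rule DERIV_cong[OF DERIV_mult[OF a' \<Phi>']])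
       (use c0 in \<open>simp add: dF_def I_def C_def \<Phi>_def \<psi>_def algebra_simps\<close>)
  then show ?thesis by (simp add: F_fun_def \<Phi>_def \<psi>_def mult.assoc)
qed

lemma dF_add: "dF lam \<xi> \<eta> (X + X') (Z + Z') = dF lam \<xi> \<eta> X Z + dF lam \<xi> \<eta> X' Z'"
proof -
  have "d_radial_speed \<xi> \<eta> (X + X') (Z + Z') = d_radial_speed \<xi> \<eta> X Z + d_radial_speed \<xi> \<eta> X' Z'"
    "d_transverse_speed \<xi> \<eta> (X + X') (Z + Z') = d_transverse_speed \<xi> \<eta> X Z + d_transverse_speed \<xi> \<eta> X' Z'"
    by (simp_all add: d_radial_speed_def d_transverse_speed_def inner_add_left inner_add_right
        cross_add_left cross_add_right add_divide_distrib distrib_left)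
  then show ?thesis by (simp add: dF_def inner_add_right algebra_simps)
qed

lemma dF_scaleR: "dF lam \<xi> \<eta> (k *\<^sub>R X) (k *\<^sub>R Z) = k * dF lam \<xi> \<eta> X Z"
proof -
  have "d_radial_speed \<xi> \<eta> (k *\<^sub>R X) (k *\<^sub>R Z) = k * d_radial_speed \<xi> \<eta> X Z"
    "d_transverse_speed \<xi> \<eta> (k *\<^sub>R X) (k *\<^sub>R Z) = k * d_transverse_speed \<xi> \<eta> X Z"
    by (simp_all add: d_radial_speed_def d_transverse_speed_def cross_mult_left cross_mult_right
        inner_add_right algebra_simps add_divide_distrib)
  then show ?thesis by (simp add: dF_def algebra_simps)
qed

text \<open>Euler's identity for the 1-homogeneous function \<open>\<eta> \<mapsto> F(\<xi>, \<eta>)\<close>.\<close>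

lemma dF_Euler:
  assumes "\<xi> \<noteq> 0" "\<eta> \<noteq> 0"
  shows "dF lam \<xi> \<eta> 0 \<eta> = F_fun lam \<xi> \<eta>"
proof -
  have n: "(norm (cross3 \<xi> \<eta>) * norm (cross3 \<xi> \<eta>)) / norm (cross3 \<xi> \<eta>) = norm (cross3 \<xi> \<eta>)"
    by simp
  have "dF lam \<xi> \<eta> 0 \<eta> = a_fun lam (norm \<xi>) * ((\<xi> \<bullet> \<eta>) / norm \<xi> * cos_integral lam (psi_angle \<xi> \<eta>)
     + lam * (norm (cross3 \<xi> \<eta>) / norm \<xi>) * cos_root lam (psi_angle \<xi> \<eta>))"
    by (simp add: dF_def d_radial_speed_def d_transverse_speed_def n flip: power2_norm_eq_inner)
       (simp add: power2_eq_square algebra_simps)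
  then show ?thesis unfolding angular_part_eq[OF assms, symmetric] by (simp add: F_fun_def mult.assoc)
qed

text \<open>If \<open>\<xi>\<close> and \<open>\<eta> = \<xi>'\<close> belong to a curve with \<open>\<eta>' = \<zeta>\<close>, the right-hand side is the derivative of \<open>k F\<close> along the
  curve: moving a curve along itself only changes \<open>F\<close> by a total derivative.\<close>

lemma dF_tangential:
  assumes "\<xi> \<noteq> 0" "\<eta> \<noteq> 0"
  shows "dF lam \<xi> \<eta> (k *\<^sub>R \<eta>) (k' *\<^sub>R \<eta> + k *\<^sub>R \<zeta>) = k * dF lam \<xi> \<eta> \<eta> \<zeta> + k' * F_fun lam \<xi> \<eta>"
proof -
  have "dF lam \<xi> \<eta> (k *\<^sub>R \<eta>) (k' *\<^sub>R \<eta> + k *\<^sub>R \<zeta>)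
      = dF lam \<xi> \<eta> (k *\<^sub>R \<eta>) (k *\<^sub>R \<zeta>) + dF lam \<xi> \<eta> (k' *\<^sub>R 0) (k' *\<^sub>R \<eta>)"
    by (simp flip: dF_add add: add.commute)
  then show ?thesis by (simp only: dF_scaleR dF_Euler[OF assms])
qed

section \<open>Integration across zero sets\<close>

text \<open>A zero at which the derivative is nonzero is isolated among the zeros. Hence \<open>S\<close> is discrete, each of
  its points is a relatively open null set, and negligibility is a local property.\<close>

lemma negligible_simple_zeros:
  fixes f :: "real \<Rightarrow> 'a::real_normed_vector"
  assumes "\<And>x. x \<in> S \<Longrightarrow> f x = 0" "\<And>x. x \<in> S \<Longrightarrow> \<exists>d. d \<noteq> 0 \<and> (f has_vector_derivative d) (at x)"
  shows "negligible S"
proof -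
  have iso: "openin (top_of_set S) {x}" if x: "x \<in> S" for x
  proof -
    obtain d where d: "d \<noteq> 0" "(f has_vector_derivative d) (at x)"
      using assms(2)[OF x] by blast
    have "((\<lambda>y. norm (f y - f x - (y - x) *\<^sub>R d) / norm (y - x)) \<longlongrightarrow> 0) (at x)"
      using d(2) by (simp add: has_vector_derivative_def has_derivative_iff_norm)
    then have "\<forall>\<^sub>F y in at x. norm (f y - f x - (y - x) *\<^sub>R d) / norm (y - x) < norm d"
      using d(1) by (intro order_tendstoD) auto
    then have "\<forall>\<^sub>F y in at x. f y \<noteq> 0"
      using eventually_neq_at_within[of x]
      by eventually_elim (auto simp: assms(1)[OF x])
    then obtain U where U: "open U" "x \<in> U" "\<And>y. y \<in> U \<Longrightarrow> y \<noteq> x \<Longrightarrow> f y \<noteq> 0"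
      unfolding eventually_at_topological by blast
    have "{x} = S \<inter> U" using U x assms(1) by auto
    then show ?thesis using U(1) by (metis openin_open)
  qed
  have "locally negligible S"
    unfolding locally_def
  proof (intro allI impI)
    fix w x assume w: "openin (top_of_set S) w \<and> x \<in> w"
    then have "x \<in> S" using openin_imp_subset by blast
    then show "\<exists>u v. openin (top_of_set S) u \<and> negligible v \<and> x \<in> u \<and> u \<subseteq> v \<and> v \<subseteq> w"
      using iso w by (intro exI[of _ "{x}"]) auto
  qed
  then show ?thesis by (simp add: locally_negligible)
qed

text \<open>The conclusion is not immediate, as \<open>h\<close> need not be differentiable on \<open>Z\<close>, which can have
  positive measure or be a Cantor set. Composing \<open>h\<close> with a \<open>C\<^sup>1\<close> function \<open>F\<^sub>k\<close>
  that is constant near \<open>0\<close> removes the problem: \<open>F\<^sub>k \<circ> h\<close> is constant near each point of \<open>Z\<close>, so the fundamental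
  theorem of calculus applies. With \<open>0 \<le> F\<^sub>k' \<le> 1\<close> and \<open>F\<^sub>k' \<rightarrow> 1\<close> away from \<open>0\<close>, dominated convergence
  yields the integral of \<open>E\<close> over \<open>{h \<noteq> 0}\<close>; and \<open>E\<close> is zero almost everywhere on \<open>{h = 0}\<close>.\<close>

lemma integral_derivative_off_zero_set:
  fixes h E :: "real \<Rightarrow> real"
  assumes ab: "a \<le> b" and hab: "h a = h b"
    and cont: "\<And>x. x \<in> {a..b} \<Longrightarrow> isCont h x"
    and der: "\<And>x. x \<in> {a..b} \<Longrightarrow> x \<notin> Z \<Longrightarrow> (h has_real_derivative E x) (at x)"
    and zero: "\<And>x. x \<in> {a..b} \<Longrightarrow> x \<in> Z \<Longrightarrow> h x = 0"
    and neg: "negligible {x \<in> {a..b}. x \<in> Z \<and> E x \<noteq> 0}"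
    and int: "E absolutely_integrable_on {a..b}"
  shows "integral {a..b} E = 0"
proof -
  \<comment> \<open>the derivative \<open>F\<^sub>k'\<close>: zero for \<open>|t| \<le> 1/(k+1)\<close> and one for \<open>|t| \<ge> 2/(k+1)\<close>\<close>
  define m where "m k t = max 0 (min 1 (real (Suc k) * \<bar>t\<bar> - 1))" for k and t :: real
  have m_cont: "isCont (m k) t" for k t
    unfolding m_def by (intro continuous_intros)
  have m_bd: "0 \<le> m k t" "m k t \<le> 1" for k t
    by (auto simp: m_def)
  have "\<exists>F. \<forall>t. (F has_real_derivative m k t) (at t)" for k
    using einterval_antiderivative[of "-\<infinity>" "\<infinity>" "m k"] m_cont
    by (auto simp: has_real_derivative_iff_has_vector_derivative)
  then obtain F where F: "\<And>k t. (F k has_real_derivative m k t) (at t)"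
    by metis
  have F0: "F k t = F k 0" if "\<bar>t\<bar> < 1 / real (Suc k)" for k t
  proof -
    have "\<exists>c. \<forall>t\<in>ball 0 (1 / real (Suc k)). F k t = c"
    proof (rule has_field_derivative_zero_constant)
      fix t :: real assume "t \<in> ball 0 (1 / real (Suc k))"
      then have "m k t = 0" by (auto simp: m_def field_simps)
      then show "(F k has_real_derivative 0) (at t within ball 0 (1 / real (Suc k)))"
        using F[of k t] by (metis has_field_derivative_at_within)
    qed simp
    then show ?thesis using that by auto
  qed
  have hi: "((\<lambda>x. m k (h x) * E x) has_integral 0) {a..b}" for k
  proof -
    have "((\<lambda>x. F k (h x)) has_real_derivative m k (h x) * E x) (at x)" if x: "x \<in> {a..b}" for x
    proof (cases "x \<in> Z")
      case False
      show ?thesis by (rule DERIV_chain2[OF F der[OF x False]])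
    next
      case True
      have "(h \<longlongrightarrow> 0) (at x)" using cont[OF x] zero[OF x True] by (simp add: isCont_def)
      then have "\<forall>\<^sub>F y in at x. dist (h y) 0 < 1 / real (Suc k)"
        by (rule tendstoD) simp
      then have "\<forall>\<^sub>F y in at x. F k (h y) = F k 0"
        by eventually_elim (auto intro: F0)
      moreover have "((\<lambda>y. F k 0) has_real_derivative 0) (at x)" by simp
      ultimately have "((\<lambda>x. F k (h x)) has_real_derivative 0) (at x)"
        using zero[OF x True]
        by (subst DERIV_cong_ev[OF refl _ refl, of _ "\<lambda>y. F k 0"])
           (auto simp: eventually_nhds_conv_at)
      then show ?thesis using zero[OF x True] by (simp add: m_def)
    qed
    then have "((\<lambda>x. m k (h x) * E x) has_integral (F k (h b) - F k (h a))) {a..b}"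
      by (intro fundamental_theorem_of_calculus ab)
         (auto simp: has_real_derivative_iff_has_vector_derivative intro: has_vector_derivative_at_within)
    then show ?thesis by (simp add: hab)
  qed
  define g where "g x = (if h x = 0 then 0 else E x)" for x
  have lim: "(\<lambda>k. m k t * y) \<longlonglongrightarrow> (if t = 0 then 0 else y)" for t y
  proof (cases "t = 0")
    case False
    have "\<forall>\<^sub>F k in sequentially. 2 / \<bar>t\<bar> \<le> real k"
      using filterlim_real_sequentially by (simp add: filterlim_at_top)
    then have "\<forall>\<^sub>F k in sequentially. m k t * y = y"
    proof eventually_elim
      case (elim k)
      then have "2 \<le> real k * \<bar>t\<bar>" using False by (simp add: field_simps)
      then have "2 \<le> real (Suc k) * \<bar>t\<bar>" by (simp add: algebra_simps)
      then show ?case by (simp add: m_def)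
    qed
    then show ?thesis using False by (simp add: tendsto_eventually)
  qed (simp add: m_def)
  have "(\<lambda>k. integral {a..b} (\<lambda>x. m k (h x) * E x)) \<longlonglongrightarrow> integral {a..b} g"
  proof (rule dominated_convergence(2))
    show "(\<lambda>x. \<bar>E x\<bar>) integrable_on {a..b}"
      using int by (simp add: absolutely_integrable_on_def)
    show "norm (m k (h x) * E x) \<le> \<bar>E x\<bar>" for k x
      using m_bd[of k "h x"] by (simp add: abs_mult mult_left_le_one_le)
  qed (use hi lim in \<open>auto simp: g_def integrable_on_def\<close>)
  moreover have "integral {a..b} (\<lambda>x. m k (h x) * E x) = 0" for k
    using hi by (rule integral_unique)
  ultimately have "integral {a..b} g = 0"
    by (simp add: LIMSEQ_const_iff)
  moreover have "integral {a..b} E = integral {a..b} g"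
  proof (rule integral_spike)
    have "negligible {x \<in> {a..b}. x \<notin> Z \<and> h x = 0 \<and> E x \<noteq> 0}"
      by (rule negligible_simple_zeros[of _ h])
         (use der in \<open>auto simp: has_real_derivative_iff_has_vector_derivative\<close>)
    then show "negligible ({x \<in> {a..b}. x \<in> Z \<and> E x \<noteq> 0} \<union> {x \<in> {a..b}. x \<notin> Z \<and> h x = 0 \<and> E x \<noteq> 0})"
      using neg by (rule negligible_Un[rotated])
  qed (auto simp: g_def)
  ultimately show ?thesis by simp
qed

text \<open>For \<open>p < 0\<close> the integrand is singular at the zeros of \<open>g\<close>. With the regularised weight
  \<open>w = (|g|\<^sup>2 + \<epsilon>)\<^sup>p\<^sup>/\<^sup>2\<close> one has
  \<open>(\<langle>g, g'\<rangle> w)' \<ge> (1 + p) |g'|\<^sup>2 w + \<langle>g, g''\<rangle> w\<close>, because differentiating \<open>w\<close> costs at most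
  \<open>|p| |g'|\<^sup>2 w\<close>. As \<open>1 + p > 0\<close> and \<open>|g| w\<close> is bounded uniformly in \<open>\<epsilon>\<close>, the integrals of \<open>|g'|\<^sup>2 w\<close> are
  bounded uniformly, and monotone convergence finishes the proof.\<close>

lemma integrable_weighted_derivative_square:
  fixes g g' g'' :: "real \<Rightarrow> 'a::euclidean_space"
  assumes ab: "a \<le> b" and p: "- 1 < p"
    and g: "\<And>x. x \<in> {a..b} \<Longrightarrow> (g has_vector_derivative g' x) (at x)"
    and g': "\<And>x. x \<in> {a..b} \<Longrightarrow> (g' has_vector_derivative g'' x) (at x)"
    and g'': "continuous_on {a..b} g''"
  shows "(\<lambda>x. (norm (g' x))\<^sup>2 * norm (g x) powr p) integrable_on {a..b}"
proof -
  have cg: "continuous_on {a..b} g" and cg': "continuous_on {a..b} g'"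
    using has_vector_derivative_continuous[OF g] has_vector_derivative_continuous[OF g']
    by (auto intro!: continuous_at_imp_continuous_on)
  show ?thesis
  proof (cases "0 \<le> p")
    case True
    have "(\<lambda>x. (norm (g' x))\<^sup>2 * norm (g x) powr p) absolutely_integrable_on {a..b}"
    proof (rule measurable_bounded_by_integrable_imp_absolutely_integrable)
      have [measurable]: "g \<in> borel_measurable (lebesgue_on {a..b})" "g' \<in> borel_measurable (lebesgue_on {a..b})"
        using cg cg' by (auto intro: continuous_imp_measurable_on_sets_lebesgue)
      show "(\<lambda>x. (norm (g' x))\<^sup>2 * norm (g x) powr p) \<in> borel_measurable (lebesgue_on {a..b})"
        by measurable
      show "(\<lambda>x. (norm (g' x))\<^sup>2 * (1 + norm (g x)) powr p) integrable_on {a..b}"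
        by (intro integrable_continuous_interval continuous_on_mult continuous_on_power continuous_on_norm
             continuous_on_powr continuous_on_add continuous_on_const cg cg') (smt (verit) norm_ge_zero)
      show "norm ((norm (g' x))\<^sup>2 * norm (g x) powr p) \<le> (norm (g' x))\<^sup>2 * (1 + norm (g x)) powr p" for x
        using True by (auto intro!: mult_left_mono powr_mono2)
    qed simp
    then show ?thesis by (simp add: absolutely_integrable_on_def)
  next
    case False
    define \<epsilon> where "\<epsilon> k = 1 / real (Suc k)" for k
    define w where "w k x = ((norm (g x))\<^sup>2 + \<epsilon> k) powr (p / 2)" for k x
    define B where "B x = ((norm (g x))\<^sup>2 + 1) powr ((1 + p) / 2)" for x
    \<comment> \<open>the weights blow up at zeros of \<open>g\<close>; those with \<open>g' \<noteq> 0\<close> form a null set, and the value \<open>0\<close> there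
  agrees with the value of the limit, since \<open>0 powr p = 0\<close>\<close>
    define f where "f k x = (if g x = 0 then 0 else (norm (g' x))\<^sup>2 * w k x)" for k x
    have \<epsilon>: "0 < \<epsilon> k" "\<epsilon> k \<le> 1" for k by (auto simp: \<epsilon>_def)
    have pos: "0 < (norm (g x))\<^sup>2 + \<epsilon> k" for k x
      using \<epsilon>(1)[of k] by (simp add: add_nonneg_pos)
    have nz: "(norm (g x))\<^sup>2 + \<epsilon> k \<noteq> 0" "(norm (g x))\<^sup>2 + 1 \<noteq> 0" for k x
      using pos[of x k] zero_le_power2[of "norm (g x)"] by linarith+
    have w0: "0 \<le> w k x" for k x by (simp add: w_def)
    have cw: "continuous_on {a..b} (w k)" for k
      unfolding w_def by (intro continuous_intros cg) (use nz in auto)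
    have cB: "continuous_on {a..b} B"
      unfolding B_def by (intro continuous_intros cg) (use nz in auto)
    have gw: "norm (g x) * w k x \<le> B x" for k x
    proof -
      have "norm (g x) \<le> ((norm (g x))\<^sup>2 + \<epsilon> k) powr (1 / 2)"
        using \<epsilon>(1)[of k] pos[of x k] by (simp add: powr_half_sqrt real_le_rsqrt)
      then have "norm (g x) * w k x \<le> ((norm (g x))\<^sup>2 + \<epsilon> k) powr (1 / 2) * w k x"
        using w0 by (rule mult_right_mono)
      also have "\<dots> = ((norm (g x))\<^sup>2 + \<epsilon> k) powr ((1 + p) / 2)"
        by (simp add: w_def add_divide_distrib flip: powr_add)
      also have "\<dots> \<le> B x"
        unfolding B_def using p \<epsilon>[of k] by (intro powr_mono2) auto
      finally show ?thesis .
    qed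
    have negl: "negligible {x \<in> {a..b}. g x = 0 \<and> g' x \<noteq> 0}"
      by (rule negligible_simple_zeros[of _ g]) (use g in auto)
    have cf: "continuous_on {a..b} (\<lambda>x. (norm (g' x))\<^sup>2 * w k x)" for k
      by (intro continuous_intros cg' cw)
    have fi: "f k integrable_on {a..b}" and fint: "integral {a..b} (f k) = integral {a..b} (\<lambda>x. (norm (g' x))\<^sup>2 * w k x)" for k
    proof -
      show "f k integrable_on {a..b}"
        by (rule integrable_spike[OF integrable_continuous_interval[OF cf] negl]) (auto simp: f_def)
      show "integral {a..b} (f k) = integral {a..b} (\<lambda>x. (norm (g' x))\<^sup>2 * w k x)"
        by (rule integral_spike[OF negl]) (auto simp: f_def)
    qed
    define H where "H k x = (g x \<bullet> g' x) * w k x" for k x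
    define H' where "H' k x = ((norm (g' x))\<^sup>2 + g x \<bullet> g'' x) * w k x
        + p * (g x \<bullet> g' x)\<^sup>2 * ((norm (g x))\<^sup>2 + \<epsilon> k) powr (p / 2 - 1)" for k x
    have Hder: "(H k has_real_derivative H' k x) (at x)" if x: "x \<in> {a..b}" for k x
    proof -
      have i1: "((\<lambda>s. g s \<bullet> g' s) has_real_derivative g x \<bullet> g'' x + g' x \<bullet> g' x) (at x)"
        using bounded_bilinear.has_vector_derivative[OF bounded_bilinear_inner g[OF x] g'[OF x]]
        by (simp add: has_real_derivative_iff_has_vector_derivative)
      have i2: "((\<lambda>s. (norm (g s))\<^sup>2 + \<epsilon> k) has_real_derivative 2 * (g x \<bullet> g' x)) (at x)"
        using bounded_bilinear.has_vector_derivative[OF bounded_bilinear_inner g[OF x] g[OF x]]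
        by (auto simp: power2_norm_eq_inner has_real_derivative_iff_has_vector_derivative inner_commute
              intro!: derivative_eq_intros)
      have i3: "(w k has_real_derivative (p / 2) * ((norm (g x))\<^sup>2 + \<epsilon> k) powr (p / 2 - 1) * (2 * (g x \<bullet> g' x))) (at x)"
        unfolding w_def by (rule DERIV_chain2[OF has_real_derivative_powr[OF pos] i2])
      show ?thesis
        unfolding H_def H'_def
        by (rule DERIV_cong[OF DERIV_mult[OF i1 i3]]) (simp add: power2_norm_eq_inner, simp add: power2_eq_square algebra_simps)
    qed
    have Hint: "(H' k has_integral (H k b - H k a)) {a..b}" for k
      by (rule fundamental_theorem_of_calculus[OF ab])
         (use Hder in \<open>auto simp: has_real_derivative_iff_has_vector_derivative intro: has_vector_derivative_at_within\<close>)
    have Hbd: "\<bar>H k x\<bar> \<le> norm (g' x) * B x" for k x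
    proof -
      have "\<bar>H k x\<bar> \<le> norm (g x) * norm (g' x) * w k x"
        unfolding H_def using Cauchy_Schwarz_ineq2[of "g x" "g' x"] w0 by (simp add: abs_mult mult_right_mono)
      also have "\<dots> \<le> norm (g' x) * B x"
        using mult_left_mono[OF gw norm_ge_zero[of "g' x"], of x k] by (simp add: algebra_simps)
      finally show ?thesis .
    qed
    have low: "(1 + p) * ((norm (g' x))\<^sup>2 * w k x) \<le> H' k x + norm (g'' x) * B x" for k x
    proof -
      let ?q = "((norm (g x))\<^sup>2 + \<epsilon> k) powr (p / 2 - 1)"
      have "(g x \<bullet> g' x)\<^sup>2 \<le> (norm (g x))\<^sup>2 * (norm (g' x))\<^sup>2"
        using Cauchy_Schwarz_ineq[of "g x" "g' x"] by (simp add: power2_norm_eq_inner)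
      also have "\<dots> \<le> ((norm (g x))\<^sup>2 + \<epsilon> k) * (norm (g' x))\<^sup>2"
        using \<epsilon>(1)[of k] by (intro mult_right_mono) auto
      finally have "(g x \<bullet> g' x)\<^sup>2 * ?q \<le> ((norm (g x))\<^sup>2 + \<epsilon> k) * (norm (g' x))\<^sup>2 * ?q"
        by (rule mult_right_mono) simp
      also have "\<dots> = (norm (g' x))\<^sup>2 * w k x"
        using pos[of x k] by (simp add: w_def powr_diff)
      finally have "p * ((norm (g' x))\<^sup>2 * w k x) \<le> p * ((g x \<bullet> g' x)\<^sup>2 * ?q)"
        using False by (intro mult_left_mono_neg) auto
      moreover have "- ((g x \<bullet> g'' x) * w k x) \<le> norm (g'' x) * B x"
      proof -
        have "- ((g x \<bullet> g'' x) * w k x) \<le> norm (g x) * norm (g'' x) * w k x"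
          using Cauchy_Schwarz_ineq2[of "g x" "g'' x"] w0[of k x] abs_ge_minus_self[of "g x \<bullet> g'' x"]
          by (metis minus_mult_left mult_right_mono order_trans)
        also have "\<dots> \<le> norm (g'' x) * B x"
          using mult_left_mono[OF gw norm_ge_zero[of "g'' x"], of x k] by (simp add: algebra_simps)
        finally show ?thesis .
      qed
      ultimately show ?thesis by (simp add: H'_def algebra_simps)
    qed
    define M where "M = (norm (g' b) * B b + norm (g' a) * B a + integral {a..b} (\<lambda>x. norm (g'' x) * B x)) / (1 + p)"
    have cM: "continuous_on {a..b} (\<lambda>x. norm (g'' x) * B x)"
      by (intro continuous_intros g'' cB)
    have fM: "integral {a..b} (f k) \<le> M" for k
    proof -
      have "(1 + p) * integral {a..b} (\<lambda>x. (norm (g' x))\<^sup>2 * w k x)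
          = integral {a..b} (\<lambda>x. (1 + p) * ((norm (g' x))\<^sup>2 * w k x))"
        by simp
      also have "\<dots> \<le> integral {a..b} (\<lambda>x. H' k x + norm (g'' x) * B x)"
        by (intro integral_le integrable_add integrable_continuous_interval[OF cM] low
            has_integral_integrable[OF Hint]
            integrable_continuous_interval[OF continuous_on_mult[OF continuous_on_const cf]])
      also have "\<dots> = (H k b - H k a) + integral {a..b} (\<lambda>x. norm (g'' x) * B x)"
        by (simp add: integral_add[OF has_integral_integrable[OF Hint] integrable_continuous_interval[OF cM]]
             integral_unique[OF Hint])
      also have "\<dots> \<le> (1 + p) * M"
        using Hbd[of k a] Hbd[of k b] p by (simp add: M_def)
      finally show ?thesis using p by (simp add: fint)
    qed
    have "(\<lambda>x. (norm (g' x))\<^sup>2 * norm (g x) powr p) integrable_on {a..b} \<and>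
       (\<lambda>k. integral {a..b} (f k)) \<longlonglongrightarrow> integral {a..b} (\<lambda>x. (norm (g' x))\<^sup>2 * norm (g x) powr p)"
    proof (rule monotone_convergence_increasing[OF fi])
      fix k x
      have "\<epsilon> (Suc k) \<le> \<epsilon> k" by (simp add: \<epsilon>_def divide_simps)
      then have "w k x \<le> w (Suc k) x"
        unfolding w_def using False pos[of x "Suc k"] by (intro powr_mono2') auto
      then show "f k x \<le> f (Suc k) x" by (auto simp: f_def intro: mult_left_mono)
    next
      fix x
      have \<epsilon>0: "\<epsilon> \<longlonglongrightarrow> 0"
        unfolding \<epsilon>_def using LIMSEQ_inverse_real_of_nat by (simp add: inverse_eq_divide)
      show "(\<lambda>k. f k x) \<longlonglongrightarrow> (norm (g' x))\<^sup>2 * norm (g x) powr p"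
      proof (cases "g x = 0")
        case False
        have "(\<lambda>k. (norm (g' x))\<^sup>2 * ((norm (g x))\<^sup>2 + \<epsilon> k) powr (p / 2))
            \<longlonglongrightarrow> (norm (g' x))\<^sup>2 * ((norm (g x))\<^sup>2 + 0) powr (p / 2)"
          using False by (intro tendsto_intros \<epsilon>0) auto
        moreover have "((norm (g x))\<^sup>2 + 0) powr (p / 2) = norm (g x) powr p"
          using False by (simp add: powr_powr flip: powr_numeral)
        ultimately show ?thesis using False by (simp add: f_def w_def)
      qed (simp add: f_def)
    next
      have "0 \<le> integral {a..b} (f k)" for k
        by (intro integral_nonneg fi) (auto simp: f_def w_def)
      then have "norm (integral {a..b} (f k)) \<le> M" for k
        using fM[of k] by simp
      then show "bounded (range (\<lambda>k. integral {a..b} (f k)))"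
        by (auto simp: bounded_iff)
    qed
    then show ?thesis by blast
  qed
qed

text \<open>Differentiate \<open>\<gamma> s z = \<gamma> s (y - 1) + \<integral> cx s\<close> under the integral sign in \<open>s\<close>, then in \<open>z\<close> at \<open>z = y\<close>.\<close>

lemma mixed_partials_commute:
  fixes \<gamma> cx cs cxs :: "real \<Rightarrow> real \<Rightarrow> 'a::euclidean_space"
  assumes x: "\<And>s x. \<alpha> < s \<Longrightarrow> (\<gamma> s has_vector_derivative cx s x) (at x)"
    and s: "\<And>s x. \<alpha> < s \<Longrightarrow> ((\<lambda>s. \<gamma> s x) has_vector_derivative cs s x) (at s)"
    and xs: "\<And>s x. \<alpha> < s \<Longrightarrow> ((\<lambda>s. cx s x) has_vector_derivative cxs s x) (at s)"
    and cx: "\<And>s. \<alpha> < s \<Longrightarrow> continuous_on UNIV (cx s)"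
    and cxs: "continuous_on ({\<alpha><..} \<times> UNIV) (\<lambda>(s, x). cxs s x)"
    and t: "\<alpha> < t"
  shows "(cs t has_vector_derivative cxs t y) (at y)"
proof -
  have I: "cs t z = cs t (y - 1) + integral {y - 1..z} (cxs t)" if z: "y - 1 \<le> z" for z
  proof -
    have eq: "\<gamma> s z = \<gamma> s (y - 1) + integral {y - 1..z} (cx s)" if "\<alpha> < s" for s
    proof -
      have "(cx s has_integral \<gamma> s z - \<gamma> s (y - 1)) {y - 1..z}"
        by (rule fundamental_theorem_of_calculus[OF z]) (use x[OF that] in \<open>auto intro: has_vector_derivative_at_within\<close>)
      then show ?thesis by (simp add: integral_unique)
    qed
    have "((\<lambda>s. integral (cbox (y - 1) z) (cx s)) has_vector_derivative integral (cbox (y - 1) z) (cxs t)) (at t within {\<alpha><..})"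
    proof (rule leibniz_rule_vector_derivative)
      show "continuous_on ({\<alpha><..} \<times> cbox (y - 1) z) (\<lambda>(s, x). cxs s x)"
        by (rule continuous_on_subset[OF cxs]) auto
      show "cx s integrable_on cbox (y - 1) z" if "s \<in> {\<alpha><..}" for s
        using cx[of s] that by (intro integrable_continuous) (auto intro: continuous_on_subset)
    qed (use xs t in \<open>auto intro: has_vector_derivative_at_within\<close>)
    then have "((\<lambda>s. integral {y - 1..z} (cx s)) has_vector_derivative integral {y - 1..z} (cxs t)) (at t)"
      using t by (simp add: at_within_open[of t "{\<alpha><..}"])
    then have "((\<lambda>s. \<gamma> s (y - 1) + integral {y - 1..z} (cx s)) has_vector_derivative
        cs t (y - 1) + integral {y - 1..z} (cxs t)) (at t)"
      by (intro has_vector_derivative_add s t)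
    moreover have "((\<lambda>s. \<gamma> s (y - 1) + integral {y - 1..z} (cx s)) has_vector_derivative d) (at t)
        \<longleftrightarrow> ((\<lambda>s. \<gamma> s z) has_vector_derivative d) (at t)" for d
      by (rule has_vector_derivative_cong_ev)
         (use eq t in \<open>auto intro!: eventually_nhds_in_open[of "{\<alpha><..}" t, THEN eventually_mono]\<close>)
    ultimately show ?thesis using s[OF t, of z] vector_derivative_unique_at by blast
  qed
  have c: "continuous_on {y - 1..y + 1} (cxs t)"
  proof -
    have "continuous_on {y - 1..y + 1} (\<lambda>x. case (t, x) of (s, x) \<Rightarrow> cxs s x)"
      by (rule continuous_on_compose2[OF cxs]) (use t in \<open>auto intro: continuous_intros\<close>)
    then show ?thesis by simp
  qed
  have "((\<lambda>z. integral {y - 1..z} (cxs t)) has_vector_derivative cxs t y) (at y within {y - 1..y + 1})"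
    by (rule integral_has_vector_derivative[OF c]) simp
  then have "((\<lambda>z. cs t (y - 1) + integral {y - 1..z} (cxs t)) has_vector_derivative 0 + cxs t y) (at y)"
    by (intro has_vector_derivative_add has_vector_derivative_const) (simp add: at_within_interior[of y "{y - 1..y + 1}"])
  then have "((\<lambda>z. cs t (y - 1) + integral {y - 1..z} (cxs t)) has_vector_derivative cxs t y) (at y)"
    by simp
  then show ?thesis
  proof (rule has_vector_derivative_transform_within_open[where S="{y - 1<..}"])
    show "cs t (y - 1) + integral {y - 1..z} (cxs t) = cs t z" if "z \<in> {y - 1<..}" for z
      using I[of z] that by simp
  qed auto
qed

section \<open>The Euler-Lagrange expression off the tangency set\<close>

text \<open>The algebraic core of the Euler-Lagrange computation, with \<open>r = |c|\<close>, \<open>\<rho> = |e|\<close>, \<open>m = \<langle>c, e\<rangle>\<close>, \<open>D = |c \<times> e|\<close>,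
  \<open>\<alpha> = \<langle>c, Y\<rangle>\<close>, \<open>\<alpha>' = \<langle>c, Y'\<rangle>\<close>, \<open>\<beta> = \<langle>Y, c''\<rangle>\<close> and \<open>k = \<langle>c, \<kappa>\<nu>\<rangle>\<close>. On the left is the derivative of the flux, on the right
  \<open>dF(Y, Y')\<close> and the remainder that will become the dissipation. The terms with \<open>I\<close> cancel, and so do
  those with \<open>\<alpha>'\<close>; the rest is a multiple of \<open>C\<close>. The value of \<open>A = a'(r) / (r a(r))\<close> enters only through
  \<open>\<lambda> A = - 1/2 + (1 - \<lambda>) / r\<^sup>2\<close>, whose second part cancels the contribution of \<open>\<psi>' = D / r\<^sup>2 + \<dots>\<close>.\<close>

lemma first_variation_scalar_identity:
  fixes a A r \<rho> m D I C \<alpha> \<alpha>' \<beta> k lam :: real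
  assumes "0 < lam" "0 < r" "0 < \<rho>" "0 < D" and D2: "D\<^sup>2 = r\<^sup>2 * \<rho>\<^sup>2 - m\<^sup>2"
    and A: "A = - 1 / (2 * lam) + (1 - lam) / (lam * r\<^sup>2)"
  shows "a * (A * r) * (m / r) * (\<alpha> / r) * (I - lam * ((m / D) * C))
      + a * ((\<alpha>' * r - \<alpha> * (m / r)) / r\<^sup>2) * (I - lam * ((m / D) * C))
      + a * (\<alpha> / r) * ((1 - lam) * C * (r * \<rho> / D)\<^sup>2 * (D / r\<^sup>2 + \<rho>\<^sup>2 * k / D))
    = a * (A * \<alpha> * (m / r * I + lam * (D / r) * C) + I * (\<alpha>' / r - m * \<alpha> / r ^ 3)
        + lam * (C * ((\<alpha> * \<rho>\<^sup>2 - r\<^sup>2 * \<beta> - m * \<alpha>') / D / r - D * \<alpha> / r ^ 3)))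
      + a * C * r / D * (\<alpha> * \<rho>\<^sup>2 / 2 + lam * \<beta> + (1 - lam) * \<alpha> * \<rho> ^ 4 * k / D\<^sup>2)"
proof -
  have i: "A * r * (m / r) * (\<alpha> / r) * I + (\<alpha>' * r - \<alpha> * (m / r)) / r\<^sup>2 * I
      = A * \<alpha> * (m / r * I) + I * (\<alpha>' / r - m * \<alpha> / r ^ 3)"
    using assms(2) by (simp add: divide_simps) (simp add: power2_eq_square power3_eq_cube algebra_simps)
  have rr: "r\<^sup>2 * \<rho>\<^sup>2 = D\<^sup>2 + m\<^sup>2" using D2 by simp
  have A': "lam * A = - 1 / 2 + (1 - lam) / r\<^sup>2"
    using assms(1,2) by (simp add: A divide_simps)
  define s where "s = D + m\<^sup>2 / D"
  have s: "s = r\<^sup>2 * \<rho>\<^sup>2 / D"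
    unfolding s_def rr using assms(4) by (simp add: add_divide_distrib power2_eq_square)
  have c1: "lam * A * \<alpha> * (D / r) + lam * A * \<alpha> * m\<^sup>2 / (r * D) = lam * A * \<alpha> * s / r"
    by (simp add: s_def add_divide_distrib distrib_left)
  have c2: "lam * \<alpha> * D / r ^ 3 + lam * \<alpha> * m\<^sup>2 / (r ^ 3 * D) = lam * \<alpha> * s / r ^ 3"
    by (simp add: s_def add_divide_distrib distrib_left)
  have c: "A * r * (m / r) * (\<alpha> / r) * (- (lam * (m / D)))
      + (\<alpha>' * r - \<alpha> * (m / r)) / r\<^sup>2 * (- (lam * (m / D)))
      + (\<alpha> / r) * ((1 - lam) * (r * \<rho> / D)\<^sup>2 * (D / r\<^sup>2 + \<rho>\<^sup>2 * k / D))
    = A * \<alpha> * (lam * (D / r))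
        + lam * ((\<alpha> * \<rho>\<^sup>2 - r\<^sup>2 * \<beta> - m * \<alpha>') / D / r - D * \<alpha> / r ^ 3)
      + r / D * (\<alpha> * \<rho>\<^sup>2 / 2 + lam * \<beta> + (1 - lam) * \<alpha> * \<rho> ^ 4 * k / D\<^sup>2)" (is "?L = ?R")
  proof -
    have "?L = - (lam * A * \<alpha> * m\<^sup>2 / (r * D)) - lam * m * \<alpha>' / (D * r) + lam * \<alpha> * m\<^sup>2 / (r ^ 3 * D)
        + (\<alpha> / r) * (1 - lam) * \<rho>\<^sup>2 / D + (1 - lam) * \<alpha> * r * \<rho> ^ 4 * k / D ^ 3"
      using assms(2-4) by (simp add: divide_simps) (simp add: power2_eq_square power3_eq_cube power4_eq_xxxx algebra_simps)
    moreover have "?R = lam * A * \<alpha> * (D / r) + lam * \<alpha> * \<rho>\<^sup>2 / (D * r) - lam * m * \<alpha>' / (D * r)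
        - lam * \<alpha> * D / r ^ 3 + r * \<alpha> * \<rho>\<^sup>2 / (2 * D) + (1 - lam) * \<alpha> * r * \<rho> ^ 4 * k / D ^ 3"
      using assms(2-4) by (simp add: divide_simps) (simp add: power2_eq_square power3_eq_cube power4_eq_xxxx algebra_simps)
    moreover have "lam * A * \<alpha> * s / r + lam * \<alpha> * \<rho>\<^sup>2 / (D * r) + r * \<alpha> * \<rho>\<^sup>2 / (2 * D)
        = lam * \<alpha> * s / r ^ 3 + (\<alpha> / r) * (1 - lam) * \<rho>\<^sup>2 / D"
      unfolding A' s using assms(2-4)
      by (simp add: divide_simps) (simp add: power2_eq_square power3_eq_cube algebra_simps)
    ultimately show ?thesis using c1 c2 by linarith
  qed
  have "a * (A * r) * (m / r) * (\<alpha> / r) * (I - lam * ((m / D) * C))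
      + a * ((\<alpha>' * r - \<alpha> * (m / r)) / r\<^sup>2) * (I - lam * ((m / D) * C))
      + a * (\<alpha> / r) * ((1 - lam) * C * (r * \<rho> / D)\<^sup>2 * (D / r\<^sup>2 + \<rho>\<^sup>2 * k / D))
    = a * (A * r * (m / r) * (\<alpha> / r) * I + (\<alpha>' * r - \<alpha> * (m / r)) / r\<^sup>2 * I)
      + a * C * (A * r * (m / r) * (\<alpha> / r) * (- (lam * (m / D)))
      + (\<alpha>' * r - \<alpha> * (m / r)) / r\<^sup>2 * (- (lam * (m / D)))
      + (\<alpha> / r) * ((1 - lam) * (r * \<rho> / D)\<^sup>2 * (D / r\<^sup>2 + \<rho>\<^sup>2 * k / D)))"
    by (simp only: ring_distribs right_diff_distrib mult_minus_right mult_minus_left) (simp add: mult_ac)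
  then show ?thesis unfolding i c
    by (simp add: algebra_simps)
qed

text \<open>For \<open>\<eta> = c'\<close> and \<open>\<zeta> = c''\<close> this is \<open>\<kappa> \<nu>\<close>. In contrast to \<open>\<nu>\<close> it depends smoothly on the curve, also where
  the curvature vanishes.\<close>

definition curvature_vector :: "real^3 \<Rightarrow> real^3 \<Rightarrow> real^3" where
  "curvature_vector \<eta> \<zeta> = (1 / norm \<eta> ^ 4) *\<^sub>R cross3 \<eta> (cross3 \<zeta> \<eta>)"

lemma curvature_vector_eq:
  assumes "\<eta> \<noteq> 0"
  shows "(norm \<eta>)\<^sup>2 *\<^sub>R curvature_vector \<eta> \<zeta> = \<zeta> - ((\<eta> \<bullet> \<zeta>) / (norm \<eta>)\<^sup>2) *\<^sub>R \<eta>"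
proof -
  have "cross3 \<eta> (cross3 \<zeta> \<eta>) = (norm \<eta>)\<^sup>2 *\<^sub>R \<zeta> - (\<eta> \<bullet> \<zeta>) *\<^sub>R \<eta>"
    by (simp add: Lagrange power2_norm_eq_inner)
  then show ?thesis
    using assms by (simp add: curvature_vector_def scaleR_diff_right power4_eq_xxxx power2_eq_square)
qed

text \<open>The failure of the Euler-Lagrange equation for a normal velocity \<open>Y\<close>, that is
  \<open>- \<langle>F\<^sub>\<xi> - (F\<^sub>\<eta>)', Y\<rangle>\<close>, at a point with position \<open>\<xi>\<close>, tangent \<open>\<eta>\<close> and second derivative \<open>\<zeta>\<close>.\<close>

definition variation_density :: "real \<Rightarrow> real^3 \<Rightarrow> real^3 \<Rightarrow> real^3 \<Rightarrow> real^3 \<Rightarrow> real" where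
  "variation_density lam \<xi> \<eta> \<zeta> Y =
     a_fun lam (norm \<xi>) * cos_root lam (psi_angle \<xi> \<eta>) * norm \<xi> / norm (cross3 \<xi> \<eta>) *
     ((\<xi> \<bullet> Y) * (norm \<eta>)\<^sup>2 / 2 + lam * (Y \<bullet> \<zeta>)
      + (1 - lam) * (\<xi> \<bullet> Y) * norm \<eta> ^ 4 * (\<xi> \<bullet> curvature_vector \<eta> \<zeta>) / (norm (cross3 \<xi> \<eta>))\<^sup>2)"

lemma psi_angle_derivative:
  fixes c e :: "real \<Rightarrow> real^3"
  assumes c: "(c has_vector_derivative e x) (at x)" and e: "(e has_vector_derivative \<zeta>) (at x)"
    and c0: "c x \<noteq> 0" and e0: "e x \<noteq> 0" and G0: "cross3 (c x) (e x) \<noteq> 0"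
  shows "((\<lambda>z. psi_angle (c z) (e z)) has_real_derivative
     norm (cross3 (c x) (e x)) / (norm (c x))\<^sup>2
     + (norm (e x))\<^sup>2 * (c x \<bullet> curvature_vector (e x) \<zeta>) / norm (cross3 (c x) (e x))) (at x)"
proof -
  define r \<rho> m D where "r = norm (c x)" and "\<rho> = norm (e x)" and "m = c x \<bullet> e x" and "D = norm (cross3 (c x) (e x))"
  have pos: "0 < r" "0 < \<rho>" "0 < D" using c0 e0 G0 by (auto simp: r_def \<rho>_def D_def)
  have D2: "D\<^sup>2 = r\<^sup>2 * \<rho>\<^sup>2 - m\<^sup>2" by (simp add: D_def r_def \<rho>_def m_def norm_cross)
  let ?\<sigma> = "m / (r * \<rho>)"
  have cosD: "sqrt (1 - ?\<sigma>\<^sup>2) = D / (r * \<rho>)"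
    using pos by (intro real_sqrt_unique) (auto simp: power_divide power_mult_distrib D2 diff_divide_distrib)
  have \<sigma>1: "?\<sigma>\<^sup>2 < 1"
  proof -
    have "1 - ?\<sigma>\<^sup>2 = (D / (r * \<rho>))\<^sup>2"
      using pos by (simp add: power_divide power_mult_distrib D2 diff_divide_distrib)
    moreover have "0 < (D / (r * \<rho>))\<^sup>2" using pos by simp
    ultimately show ?thesis by linarith
  qed
  have \<sigma>: "-1 < ?\<sigma>" "?\<sigma> < 1" using \<sigma>1 unfolding abs_square_less_1 abs_less_iff by linarith+
  have d: "((\<lambda>z. (c z \<bullet> e z) / (norm (c z) * norm (e z))) has_real_derivative
      ((c x \<bullet> \<zeta> + e x \<bullet> e x) * (r * \<rho>) - m * (((c x \<bullet> e x) / r) * \<rho> + ((e x \<bullet> \<zeta>) / \<rho>) * r)) / ((r * \<rho>) * (r * \<rho>))) (at x)"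
    unfolding r_def \<rho>_def m_def
    by (rule DERIV_divide[OF inner_has_real_derivative[OF c e]
          DERIV_mult[OF norm_has_real_derivative[OF c c0] norm_has_real_derivative[OF e e0]]])
       (use c0 e0 in auto)
  have "((\<lambda>z. arcsin ((c z \<bullet> e z) / (norm (c z) * norm (e z)))) has_real_derivative
      inverse (sqrt (1 - ?\<sigma>\<^sup>2)) * (((c x \<bullet> \<zeta> + e x \<bullet> e x) * (r * \<rho>) - m * (((c x \<bullet> e x) / r) * \<rho> + ((e x \<bullet> \<zeta>) / \<rho>) * r)) / ((r * \<rho>) * (r * \<rho>)))) (at x)"
    by (rule DERIV_chain2[OF _ d]) (use DERIV_arcsin[OF \<sigma>] in \<open>simp add: m_def r_def \<rho>_def\<close>)
  moreover have "inverse (sqrt (1 - ?\<sigma>\<^sup>2)) * (((c x \<bullet> \<zeta> + e x \<bullet> e x) * (r * \<rho>) - m * (((c x \<bullet> e x) / r) * \<rho> + ((e x \<bullet> \<zeta>) / \<rho>) * r)) / ((r * \<rho>) * (r * \<rho>)))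
      = D / r\<^sup>2 + \<rho>\<^sup>2 * (c x \<bullet> curvature_vector (e x) \<zeta>) / D"
  proof -
    have k: "\<rho>\<^sup>2 * (c x \<bullet> curvature_vector (e x) \<zeta>) = c x \<bullet> \<zeta> - (e x \<bullet> \<zeta>) * m / \<rho>\<^sup>2"
      using arg_cong[OF curvature_vector_eq[OF e0], of "\<lambda>v. c x \<bullet> v"]
      by (simp add: inner_diff_right \<rho>_def m_def)
    have rr: "D / r\<^sup>2 = (\<rho>\<^sup>2 - m\<^sup>2 / r\<^sup>2) / D"
    proof -
      have "D / r\<^sup>2 = D\<^sup>2 / (r\<^sup>2 * D)" using pos by (simp add: power2_eq_square)
      then show ?thesis unfolding D2 using pos by (simp add: divide_simps)
    qed
    have ee: "e x \<bullet> e x = \<rho>\<^sup>2" by (simp add: \<rho>_def power2_norm_eq_inner)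
    show ?thesis
      unfolding cosD k rr ee m_def[symmetric] using pos
      by (simp add: divide_simps power2_eq_square algebra_simps)
  qed
  ultimately show ?thesis by (simp add: psi_angle_def r_def \<rho>_def D_def)
qed

text \<open>For \<open>Y \<perp> e\<close> the flux \<open>dF(0, Y) = \<langle>F\<^sub>\<eta>, Y\<rangle>\<close> is \<open>a \<langle>c, Y\<rangle>/|c| \<cdot> (I \<psi> - \<lambda> tan \<psi> cos\<^sup>1\<^sup>/\<^sup>\<lambda> \<psi>)\<close> where \<open>c \<times> e \<noteq> 0\<close>, a
  product of functions of one variable. Two facts keep the computation short: \<open>\<langle>c, Y\<rangle>' = \<langle>c, Y'\<rangle>\<close> and
  \<open>\<langle>e, Y'\<rangle> = - \<langle>c'', Y\<rangle>\<close>, both from \<open>Y \<perp> e\<close>.\<close>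

lemma normal_flux_derivative:
  fixes c e Y :: "real \<Rightarrow> real^3"
  assumes lam: "0 < lam"
    and c: "\<And>z. (c has_vector_derivative e z) (at z)" and e: "(e has_vector_derivative \<zeta>) (at x)"
    and Y: "(Y has_vector_derivative Y') (at x)"
    and c0: "\<And>z. c z \<noteq> 0" and e0: "\<And>z. e z \<noteq> 0" and perp: "\<And>z. e z \<bullet> Y z = 0"
    and G0: "cross3 (c x) (e x) \<noteq> 0"
  shows "((\<lambda>z. dF lam (c z) (e z) 0 (Y z)) has_real_derivative
     dF lam (c x) (e x) (Y x) Y' + variation_density lam (c x) (e x) \<zeta> (Y x)) (at x)"
proof -
  define \<psi> where "\<psi> z = psi_angle (c z) (e z)" for z
  define T where "T \<theta> = cos_integral lam \<theta> - lam * (tan \<theta> * cos_root lam \<theta>)" for \<theta>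
  define r \<rho> m D where "r = norm (c x)" and "\<rho> = norm (e x)" and "m = c x \<bullet> e x" and "D = norm (cross3 (c x) (e x))"
  define \<alpha> \<alpha>' \<beta> k where "\<alpha> = c x \<bullet> Y x" and "\<alpha>' = c x \<bullet> Y'" and "\<beta> = Y x \<bullet> \<zeta>" and "k = c x \<bullet> curvature_vector (e x) \<zeta>"
  define I C where "I = cos_integral lam (\<psi> x)" and "C = cos_root lam (\<psi> x)"
  have pos: "0 < r" "0 < \<rho>" "0 < D" using c0 e0 G0 by (auto simp: r_def \<rho>_def D_def)
  have D2: "D\<^sup>2 = r\<^sup>2 * \<rho>\<^sup>2 - m\<^sup>2" by (simp add: D_def r_def \<rho>_def m_def norm_cross)
  have cos\<psi>: "cos (\<psi> x) = D / (r * \<rho>)" and tan\<psi>: "tan (\<psi> x) = m / D"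
    using pos by (auto simp: \<psi>_def tan_def sin_psi_angle cos_psi_angle[OF c0 e0] m_def r_def \<rho>_def D_def)
  have h: "dF lam (c z) (e z) 0 (Y z) = a_fun lam (norm (c z)) * ((c z \<bullet> Y z) / norm (c z)) * T (\<psi> z)"
    if "cross3 (c z) (e z) \<noteq> 0" for z
  proof -
    have "cross3 (c z) (e z) \<bullet> cross3 (c z) (Y z) = - ((c z \<bullet> Y z) * (c z \<bullet> e z))"
      using perp[of z] by (simp add: dot_cross inner_commute)
    moreover have "tan (\<psi> z) = (c z \<bullet> e z) / norm (cross3 (c z) (e z))"
      using that c0[of z] e0[of z] by (simp add: \<psi>_def tan_def sin_psi_angle cos_psi_angle)
    ultimately show ?thesis
      by (simp add: dF_def d_radial_speed_def d_transverse_speed_def T_def \<psi>_def algebra_simps)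
  qed
  have \<psi>': "(\<psi> has_real_derivative D / r\<^sup>2 + \<rho>\<^sup>2 * k / D) (at x)"
    unfolding \<psi>_def D_def r_def \<rho>_def k_def by (rule psi_angle_derivative[OF c e c0 e0 G0])
  have r': "((\<lambda>z. norm (c z)) has_real_derivative m / r) (at x)"
    unfolding m_def r_def by (rule norm_has_real_derivative[OF c c0])
  have a': "((\<lambda>z. a_fun lam (norm (c z))) has_real_derivative
      a_fun lam r * (dlog_a lam r * r) * (m / r)) (at x)"
    unfolding r_def by (rule DERIV_chain2[OF a_fun_derivative r'[unfolded r_def]]) (use lam c0 in auto)
  have \<alpha>d: "((\<lambda>z. c z \<bullet> Y z) has_real_derivative \<alpha>') (at x)"
    using inner_has_real_derivative[OF c Y] perp by (simp add: \<alpha>'_def)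
  have q': "((\<lambda>z. (c z \<bullet> Y z) / norm (c z)) has_real_derivative (\<alpha>' * r - \<alpha> * (m / r)) / r\<^sup>2) (at x)"
    using DERIV_divide[OF \<alpha>d r'] pos by (simp add: r_def \<alpha>_def power2_eq_square)
  have b: "\<bar>\<psi> x\<bar> < pi / 2" unfolding \<psi>_def by (rule psi_angle_interior[OF c0 e0 G0])
  have cn: "cos (\<psi> x) \<noteq> 0" using cos\<psi> pos by simp
  have T': "(T has_real_derivative (1 - lam) * C * (r * \<rho> / D)\<^sup>2) (at (\<psi> x))"
  proof -
    have "(T has_real_derivative C - lam * (inverse ((cos (\<psi> x))\<^sup>2) * C + - (1/lam) * C * tan (\<psi> x) * tan (\<psi> x))) (at (\<psi> x))"
      unfolding T_def C_def
      by (intro DERIV_diff DERIV_cmult DERIV_mult DERIV_tan cn cos_integral_derivative_interior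
          cos_root_derivative lam b)
    moreover have "C - lam * (inverse ((cos (\<psi> x))\<^sup>2) * C + - (1/lam) * C * tan (\<psi> x) * tan (\<psi> x))
        = (1 - lam) * C * (r * \<rho> / D)\<^sup>2"
    proof -
      have s: "1 + (m / D)\<^sup>2 = (r * \<rho> / D)\<^sup>2"
      proof -
        have "1 + (m / D)\<^sup>2 = (D\<^sup>2 + m\<^sup>2) / D\<^sup>2" using pos by (simp add: power_divide add_divide_distrib)
        then show ?thesis by (simp add: D2 power_divide power_mult_distrib)
      qed
      have "C - lam * (inverse ((cos (\<psi> x))\<^sup>2) * C + - (1/lam) * C * tan (\<psi> x) * tan (\<psi> x))
        = C * (1 + (m / D)\<^sup>2) - lam * C * (r * \<rho> / D)\<^sup>2"
        unfolding cos\<psi> tan\<psi> using lam by (simp add: power_divide power2_eq_square algebra_simps)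
      then show ?thesis unfolding s by (simp add: algebra_simps)
    qed
    ultimately show ?thesis by simp
  qed
  have "((\<lambda>z. a_fun lam (norm (c z)) * ((c z \<bullet> Y z) / norm (c z)) * T (\<psi> z)) has_real_derivative
     a_fun lam r * (dlog_a lam r * r) * (m / r) * (\<alpha> / r) * (I - lam * ((m / D) * C))
      + a_fun lam r * ((\<alpha>' * r - \<alpha> * (m / r)) / r\<^sup>2) * (I - lam * ((m / D) * C))
      + a_fun lam r * (\<alpha> / r) * ((1 - lam) * C * (r * \<rho> / D)\<^sup>2 * (D / r\<^sup>2 + \<rho>\<^sup>2 * k / D))) (at x)"
    by (rule DERIV_cong[OF DERIV_mult[OF DERIV_mult[OF a' q'] DERIV_chain2[OF T' \<psi>']]])
       (simp add: T_def tan\<psi> I_def C_def r_def \<alpha>_def algebra_simps)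
  moreover have "a_fun lam r * (dlog_a lam r * r) * (m / r) * (\<alpha> / r) * (I - lam * ((m / D) * C))
      + a_fun lam r * ((\<alpha>' * r - \<alpha> * (m / r)) / r\<^sup>2) * (I - lam * ((m / D) * C))
      + a_fun lam r * (\<alpha> / r) * ((1 - lam) * C * (r * \<rho> / D)\<^sup>2 * (D / r\<^sup>2 + \<rho>\<^sup>2 * k / D))
      = dF lam (c x) (e x) (Y x) Y' + variation_density lam (c x) (e x) \<zeta> (Y x)"
  proof -
    have "((\<lambda>z. e z \<bullet> Y z) has_real_derivative e x \<bullet> Y' + \<zeta> \<bullet> Y x) (at x)"
      by (rule inner_has_real_derivative[OF e Y])
    then have "e x \<bullet> Y' + \<zeta> \<bullet> Y x = 0"
      using DERIV_unique[of "\<lambda>z. 0" _ x 0] by (simp add: perp)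
    then have eY': "e x \<bullet> Y' = - \<beta>" by (simp add: \<beta>_def inner_commute)
    have G: "cross3 (c x) (e x) \<bullet> (cross3 (Y x) (e x) + cross3 (c x) Y') = \<alpha> * \<rho>\<^sup>2 - r\<^sup>2 * \<beta> - m * \<alpha>'"
      using perp[of x] eY'
      by (simp add: inner_add_right dot_cross power2_norm_eq_inner \<alpha>_def \<rho>_def r_def m_def \<alpha>'_def inner_commute)
    show ?thesis
      unfolding first_variation_scalar_identity[OF lam pos D2 dlog_a_def, where \<beta> = \<beta>]
      unfolding dF_def d_radial_speed_def d_transverse_speed_def G angular_part_eq[OF c0 e0]
      using perp[of x]
      by (simp add: variation_density_def I_def C_def \<psi>_def r_def \<rho>_def D_def m_def \<alpha>_def \<alpha>'_def \<beta>_def k_def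
          inner_commute[of "Y x" "e x"] dlog_a_def)
  qed
  ultimately have "((\<lambda>z. a_fun lam (norm (c z)) * ((c z \<bullet> Y z) / norm (c z)) * T (\<psi> z)) has_real_derivative
      dF lam (c x) (e x) (Y x) Y' + variation_density lam (c x) (e x) \<zeta> (Y x)) (at x)"
    by simp
  moreover have "\<forall>\<^sub>F z in nhds x. dF lam (c z) (e z) 0 (Y z) = a_fun lam (norm (c z)) * ((c z \<bullet> Y z) / norm (c z)) * T (\<psi> z)"
  proof -
    have "((\<lambda>z. cross3 (c z) (e z)) \<longlongrightarrow> cross3 (c x) (e x)) (at x)"
      using has_vector_derivative_continuous[OF cross3_has_vector_derivative[OF c e]] by (simp add: isCont_def)
    then have "\<forall>\<^sub>F z in at x. cross3 (c z) (e z) \<noteq> 0"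
      using G0 by (rule tendsto_imp_eventually_ne)
    then have "\<forall>\<^sub>F z in nhds x. cross3 (c z) (e z) \<noteq> 0"
      using G0 by (simp add: eventually_nhds_conv_at)
    then show ?thesis by eventually_elim (rule h)
  qed
  ultimately show ?thesis
    by (subst DERIV_cong_ev[OF refl _ refl]) auto
qed

section \<open>Curvature, normal and binormal terms\<close>

text \<open>This isolates the possibly singular factor \<open>|\<xi> \<times> \<eta>|\<^sup>1\<^sup>/\<^sup>\<lambda>\<^sup>-\<^sup>1\<close>. It holds without exception, as both sides
  are \<open>0\<close> at \<open>\<xi> \<times> \<eta> = 0\<close> by \<open>1 / 0 = 0\<close> and \<open>0 powr _ = 0\<close>.\<close>

lemma rho_fun_eq:
  assumes lam: "0 < lam" and "\<xi> \<noteq> 0" "\<eta> \<noteq> 0"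
  shows "rho_fun lam \<xi> \<eta> = a_fun lam (norm \<xi>) * norm \<eta> * (norm \<xi> * norm \<eta>) powr (1 - 1 / lam)
      * norm (cross3 \<xi> \<eta>) powr (1 / lam - 1)"
proof -
  define k where "k = (lam - 1) / lam"
  have k: "1 - 1 / lam = k" "1 / lam - 1 = - k" using lam by (auto simp: k_def field_simps)
  have "g_fun lam (psi_angle \<xi> \<eta>) = (norm \<xi> * norm \<eta>) powr k * norm (cross3 \<xi> \<eta>) powr (- k)"
    using assms by (simp add: g_fun_def cos_psi_angle powr_divide powr_minus_divide flip: k_def)
  then show ?thesis by (simp add: rho_fun_def k)
qed

lemma rho_fun_degenerate:
  assumes "0 < lam" "\<xi> \<noteq> 0" "\<eta> \<noteq> 0" "cross3 \<xi> \<eta> = 0"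
  shows "rho_fun lam \<xi> \<eta> = 0"
  using assms by (simp add: rho_fun_eq)

lemma rho_fun_eq_cos_root:
  assumes lam: "0 < lam" and "\<xi> \<noteq> 0" "\<eta> \<noteq> 0" "cross3 \<xi> \<eta> \<noteq> 0"
  shows "rho_fun lam \<xi> \<eta> = a_fun lam (norm \<xi>) * cos_root lam (psi_angle \<xi> \<eta>) * norm \<xi> * (norm \<eta>)\<^sup>2 / norm (cross3 \<xi> \<eta>)"
proof -
  define D s where "D = norm (cross3 \<xi> \<eta>)" and "s = norm \<xi> * norm \<eta>"
  have pos: "0 < D" "0 < s" using assms by (auto simp: D_def s_def)
  have "s powr (1 - 1 / lam) * D powr (1 / lam - 1) = (D / s) powr (1 / lam) * s / D"
    using pos by (simp add: powr_diff powr_divide)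
  moreover have "cos_root lam (psi_angle \<xi> \<eta>) = (D / s) powr (1 / lam)"
    using assms by (simp add: cos_root_def cos_psi_angle D_def s_def)
  moreover have "rho_fun lam \<xi> \<eta> = a_fun lam (norm \<xi>) * norm \<eta> * (s powr (1 - 1 / lam) * D powr (1 / lam - 1))"
    using assms by (simp add: rho_fun_eq D_def s_def)
  ultimately show ?thesis
    by (simp add: D_def[symmetric]) (simp add: s_def power2_eq_square)
qed

lemma rho_fun_nonneg: "0 \<le> rho_fun lam \<xi> \<eta>"
  by (simp add: rho_fun_def a_fun_def g_fun_def)

lemma norm_line_proj_square: "(norm (line_proj w v))\<^sup>2 = (v \<bullet> w)\<^sup>2 / (w \<bullet> w)"
  by (cases "w = 0") (simp_all add: line_proj_def power_mult_distrib power_divide power2_norm_eq_inner, simp add: power2_eq_square)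

lemma cross_unit_normal:
  assumes "norm \<nu> = 1" "\<nu> \<bullet> \<eta> = 0"
  shows "cross3 \<nu> \<eta> \<bullet> cross3 \<nu> \<eta> = (norm \<eta>)\<^sup>2"
    and "(\<xi> \<bullet> cross3 \<nu> \<eta>)\<^sup>2 = (norm (cross3 \<xi> \<eta>))\<^sup>2 - (\<xi> \<bullet> \<nu>)\<^sup>2 * (norm \<eta>)\<^sup>2"
proof -
  have n: "\<nu> \<bullet> \<nu> = 1" using assms(1) by (simp flip: power2_norm_eq_inner)
  show w: "cross3 \<nu> \<eta> \<bullet> cross3 \<nu> \<eta> = (norm \<eta>)\<^sup>2"
    using assms n by (simp add: dot_cross power2_norm_eq_inner inner_commute)
  have "cross3 \<xi> (cross3 \<nu> \<eta>) = (\<xi> \<bullet> \<eta>) *\<^sub>R \<nu> - (\<xi> \<bullet> \<nu>) *\<^sub>R \<eta>" by (rule Lagrange)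
  then have "(norm (cross3 \<xi> (cross3 \<nu> \<eta>)))\<^sup>2 = (\<xi> \<bullet> \<eta>)\<^sup>2 + (\<xi> \<bullet> \<nu>)\<^sup>2 * (norm \<eta>)\<^sup>2"
    using assms n
    by (simp add: power2_norm_eq_inner inner_diff_left inner_diff_right inner_commute[of \<eta> \<nu>])
       (simp add: power2_eq_square)
  then show "(\<xi> \<bullet> cross3 \<nu> \<eta>)\<^sup>2 = (norm (cross3 \<xi> \<eta>))\<^sup>2 - (\<xi> \<bullet> \<nu>)\<^sup>2 * (norm \<eta>)\<^sup>2"
    using norm_cross[of \<xi> "cross3 \<nu> \<eta>"] norm_cross[of \<xi> \<eta>] w
    by (simp add: power2_norm_eq_inner[of "cross3 \<nu> \<eta>"])
qed

lemma binormal_projection: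
  assumes "norm \<nu> = 1" "\<nu> \<bullet> \<eta> = 0" "\<eta> \<noteq> 0"
  shows "(norm (line_proj (cross3 \<nu> \<eta>) \<xi>))\<^sup>2 = (norm (cross3 \<xi> \<eta>))\<^sup>2 / (norm \<eta>)\<^sup>2 - (\<xi> \<bullet> \<nu>)\<^sup>2"
  using assms by (simp add: norm_line_proj_square cross_unit_normal diff_divide_distrib)

text \<open>Split the normal part \<open>N\<close> of \<open>\<xi>\<close> along \<open>\<nu>\<close> and \<open>\<nu> \<times> \<eta>\<close>, \<open>|N|\<^sup>2 = n\<^sup>2 + b\<^sup>2\<close> with \<open>n = \<langle>\<xi>, \<nu>\<rangle>\<close>. The density is then
  \<open>\<rho>\<close> times a quadratic polynomial in \<open>\<kappa>\<close>, and completing the square to \<open>(\<kappa> + n/2)\<^sup>2\<close> leaves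
  \<open>b\<^sup>2/4 + (\<lambda> - 1) \<kappa>\<^sup>2 b\<^sup>2 / |N|\<^sup>2\<close>. For \<open>\<kappa> = 0\<close> any unit normal \<open>\<nu>\<close> is allowed.\<close>

lemma variation_density_eq:
  assumes lam: "0 < lam" and \<xi>0: "\<xi> \<noteq> 0" and \<eta>0: "\<eta> \<noteq> 0" and G0: "cross3 \<xi> \<eta> \<noteq> 0"
    and \<nu>: "norm \<nu> = 1" "\<nu> \<bullet> \<eta> = 0" and K: "curvature_vector \<eta> \<zeta> = \<kappa> *\<^sub>R \<nu>"
    and Y: "Y = (1 / 2) *\<^sub>R (\<xi> - ((\<xi> \<bullet> \<eta>) / (norm \<eta>)\<^sup>2) *\<^sub>R \<eta>) + \<kappa> *\<^sub>R \<nu>"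
  shows "variation_density lam \<xi> \<eta> \<zeta> Y =
      \<bar>\<kappa> + 1 / 2 * (\<xi> \<bullet> \<nu>)\<bar>\<^sup>2 * rho_fun lam \<xi> \<eta>
      + (1 / 4 + (lam - 1) * (\<kappa>\<^sup>2 / ((norm \<xi>)\<^sup>2 * (cos (psi_angle \<xi> \<eta>))\<^sup>2)))
        * (norm (line_proj (cross3 \<nu> \<eta>) \<xi>))\<^sup>2 * rho_fun lam \<xi> \<eta>"
proof -
  define r \<rho> m D n N where "r = norm \<xi>" and "\<rho> = norm \<eta>" and "m = \<xi> \<bullet> \<eta>" and "D = norm (cross3 \<xi> \<eta>)"
    and "n = \<xi> \<bullet> \<nu>" and "N = D\<^sup>2 / \<rho>\<^sup>2"
  have pos: "0 < r" "0 < \<rho>" "0 < D" using \<xi>0 \<eta>0 G0 by (auto simp: r_def \<rho>_def D_def)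
  have N0: "0 < N" using pos by (simp add: N_def)
  have D2: "D\<^sup>2 = r\<^sup>2 * \<rho>\<^sup>2 - m\<^sup>2" by (simp add: D_def r_def \<rho>_def m_def norm_cross)
  have \<xi>\<xi>: "\<xi> \<bullet> \<xi> = r\<^sup>2" and \<eta>\<eta>: "\<eta> \<bullet> \<eta> = \<rho>\<^sup>2" and \<nu>\<nu>: "\<nu> \<bullet> \<nu> = 1"
    using \<nu>(1) by (simp_all add: r_def \<rho>_def flip: power2_norm_eq_inner)
  have \<alpha>: "\<xi> \<bullet> Y = N / 2 + \<kappa> * n"
  proof -
    have "\<xi> \<bullet> Y = 1 / 2 * (r\<^sup>2 - m / \<rho>\<^sup>2 * m) + \<kappa> * n"
      by (simp add: Y inner_add_right inner_diff_right \<xi>\<xi> flip: m_def n_def \<rho>_def)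
    moreover have "r\<^sup>2 - m / \<rho>\<^sup>2 * m = N"
      unfolding N_def D2 using pos by (simp add: diff_divide_distrib power2_eq_square)
    ultimately show ?thesis by simp
  qed
  have Y\<eta>: "Y \<bullet> \<eta> = 0" and Y\<nu>: "Y \<bullet> \<nu> = n / 2 + \<kappa>"
    using pos \<nu>(2) by (simp_all add: Y inner_add_left inner_diff_left \<eta>\<eta> \<nu>\<nu> n_def inner_commute[of \<eta> \<nu>] flip: m_def \<rho>_def)
  have \<beta>: "Y \<bullet> \<zeta> = \<kappa> * \<rho>\<^sup>2 * (n / 2 + \<kappa>)"
  proof -
    have "Y \<bullet> (\<rho>\<^sup>2 *\<^sub>R (\<kappa> *\<^sub>R \<nu>)) = Y \<bullet> \<zeta>"
      using curvature_vector_eq[OF \<eta>0, of \<zeta>] by (simp add: K inner_diff_right Y\<eta> flip: \<rho>_def)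
    then show ?thesis by (simp add: Y\<nu> algebra_simps)
  qed
  have k: "\<xi> \<bullet> curvature_vector \<eta> \<zeta> = \<kappa> * n" by (simp add: K n_def)
  have r\<rho>: "(norm \<xi>)\<^sup>2 * (cos (psi_angle \<xi> \<eta>))\<^sup>2 = N"
    using pos by (simp add: cos_psi_angle[OF \<xi>0 \<eta>0] N_def power_divide power_mult_distrib flip: r_def \<rho>_def D_def)
  have b: "(norm (line_proj (cross3 \<nu> \<eta>) \<xi>))\<^sup>2 = N - n\<^sup>2"
    by (simp add: binormal_projection[OF \<nu> \<eta>0] N_def D_def \<rho>_def n_def)
  define q where "q = a_fun lam r * cos_root lam (psi_angle \<xi> \<eta>) * r / D"
  have \<rho>f: "rho_fun lam \<xi> \<eta> = q * \<rho>\<^sup>2"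
    by (simp add: rho_fun_eq_cos_root[OF lam \<xi>0 \<eta>0 G0] q_def r_def \<rho>_def D_def)
  have "variation_density lam \<xi> \<eta> \<zeta> Y = q * ((N / 2 + \<kappa> * n) * \<rho>\<^sup>2 / 2 + lam * (\<kappa> * \<rho>\<^sup>2 * (n / 2 + \<kappa>))
      + (1 - lam) * (N / 2 + \<kappa> * n) * \<rho> ^ 4 * (\<kappa> * n) / D\<^sup>2)"
    by (simp add: variation_density_def \<alpha> \<beta> k q_def r_def \<rho>_def D_def)
  also have "\<dots> = q * \<rho>\<^sup>2 * ((N / 2 + \<kappa> * n) / 2 + lam * (\<kappa> * (n / 2 + \<kappa>)) + (1 - lam) * (N / 2 + \<kappa> * n) * (\<kappa> * n) / N)"
    using pos by (simp add: N_def power4_eq_xxxx power2_eq_square algebra_simps)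
  also have "\<dots> = \<bar>\<kappa> + 1 / 2 * n\<bar>\<^sup>2 * (q * \<rho>\<^sup>2) + (1 / 4 + (lam - 1) * (\<kappa>\<^sup>2 / N)) * (N - n\<^sup>2) * (q * \<rho>\<^sup>2)"
    using N0 by (simp add: divide_simps) (simp add: power2_eq_square algebra_simps)
  finally show ?thesis by (simp only: \<rho>f r\<rho> b n_def)
qed

lemma unit_normal_fieldD:
  assumes "unit_normal_field c \<nu>" "x \<in> {0..2*pi}" "curve_d c x \<noteq> 0"
  shows "norm (\<nu> x) = 1" "\<nu> x \<bullet> curve_d c x = 0"
    and "curvature_vector (curve_d c x) (curve_dd c x) = curvature c x *\<^sub>R \<nu> x"
proof -
  let ?e = "curve_d c x" and ?b = "cross3 (curve_dd c x) (curve_d c x)"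
  have K0: "curvature_vector ?e (curve_dd c x) = 0" if "curvature c x = 0"
    using that assms(3) by (simp add: curvature_def curvature_vector_def)
  have *: "norm (cross3 ?e ?b) = norm ?e * norm ?b"
  proof (rule power2_eq_imp_eq)
    show "(norm (cross3 ?e ?b))\<^sup>2 = (norm ?e * norm ?b)\<^sup>2"
      by (simp add: norm_cross dot_cross_self power_mult_distrib)
  qed auto
  have cases: "if curvature c x \<noteq> 0 then \<nu> x = (1 / (norm ?e * norm ?b)) *\<^sub>R cross3 ?e ?b
      else norm (\<nu> x) = 1 \<and> \<nu> x \<bullet> ?e = 0"
    using assms(1,2) unfolding unit_normal_field_def by blast
  have nz: "norm ?b \<noteq> 0" if "curvature c x \<noteq> 0" using that by (auto simp: curvature_def)
  show "norm (\<nu> x) = 1"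
    using cases nz assms(3) by (auto simp: * split: if_splits)
  show "\<nu> x \<bullet> ?e = 0"
    using cases by (auto simp: inner_commute dot_cross_self split: if_splits)
  show "curvature_vector ?e (curve_dd c x) = curvature c x *\<^sub>R \<nu> x"
  proof (cases "curvature c x = 0")
    case False
    then show ?thesis
      using cases nz assms(3)
      by (auto simp: curvature_vector_def curvature_def power4_eq_xxxx power3_eq_cube)
  qed (simp add: K0)
qed

text \<open>With \<open>G = \<xi> \<times> \<eta>\<close> and \<open>G' = \<xi> \<times> \<zeta>\<close>, two vector triple products give
  \<open>\<langle>\<xi>, \<eta>\<rangle> (\<zeta> \<times> \<eta>) = \<eta> \<times> (\<eta> \<times> G') + \<langle>\<eta>, \<zeta>\<rangle> G\<close>. So \<open>\<langle>\<xi>, \<eta>\<rangle> \<kappa>\<close> is controlled by \<open>|G'|\<close> and \<open>|G|\<close>; and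
  \<open>|G| \<kappa>\<close> is trivially controlled by \<open>|G|\<close>. Since \<open>\<langle>\<xi>, \<eta>\<rangle>\<^sup>2 + |G|\<^sup>2 = |\<xi>|\<^sup>2 |\<eta>|\<^sup>2\<close>, the two cases combine into one
  estimate for \<open>\<kappa>\<close> itself.\<close>

lemma curvature_bound:
  assumes \<xi>0: "\<xi> \<noteq> 0" and \<eta>0: "\<eta> \<noteq> 0"
  shows "(norm (cross3 \<zeta> \<eta>) / norm \<eta> ^ 3)\<^sup>2
      \<le> (2 * (norm \<eta>)\<^sup>2 * (norm (cross3 \<xi> \<zeta>))\<^sup>2 + 3 * (norm \<zeta>)\<^sup>2 * (norm (cross3 \<xi> \<eta>))\<^sup>2) / ((norm \<xi>)\<^sup>2 * norm \<eta> ^ 6)"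
proof -
  define r \<rho> m D z g b where "r = norm \<xi>" and "\<rho> = norm \<eta>" and "m = \<xi> \<bullet> \<eta>" and "D = norm (cross3 \<xi> \<eta>)"
    and "z = norm \<zeta>" and "g = norm (cross3 \<xi> \<zeta>)" and "b = norm (cross3 \<zeta> \<eta>)"
  have pos: "0 < r" "0 < \<rho>" using \<xi>0 \<eta>0 by (auto simp: r_def \<rho>_def)
  have rr: "r\<^sup>2 * \<rho>\<^sup>2 = D\<^sup>2 + m\<^sup>2" by (simp add: D_def r_def \<rho>_def m_def norm_cross)
  have cr: "norm (cross3 u v) \<le> norm u * norm v" for u v :: "real^3"
    by (rule power2_le_imp_le) (auto simp: norm_cross power_mult_distrib)
  have "cross3 \<eta> (cross3 \<eta> (cross3 \<xi> \<zeta>)) = (\<eta> \<bullet> \<zeta>) *\<^sub>R cross3 \<eta> \<xi> - m *\<^sub>R cross3 \<eta> \<zeta>"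
    by (simp add: Lagrange[of \<eta> \<xi> \<zeta>] Cross3.right_diff_distrib cross_mult_right m_def inner_commute)
  then have "m *\<^sub>R cross3 \<zeta> \<eta> = cross3 \<eta> (cross3 \<eta> (cross3 \<xi> \<zeta>)) + (\<eta> \<bullet> \<zeta>) *\<^sub>R cross3 \<xi> \<eta>"
    using cross_skew[of \<zeta> \<eta>] cross_skew[of \<xi> \<eta>] by (simp add: algebra_simps)
  then have "\<bar>m\<bar> * b \<le> norm (cross3 \<eta> (cross3 \<eta> (cross3 \<xi> \<zeta>))) + \<bar>\<eta> \<bullet> \<zeta>\<bar> * D"
    using norm_triangle_ineq[of "cross3 \<eta> (cross3 \<eta> (cross3 \<xi> \<zeta>))" "(\<eta> \<bullet> \<zeta>) *\<^sub>R cross3 \<xi> \<eta>"]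
    by (metis D_def b_def norm_scaleR)
  also have "\<dots> \<le> \<rho> * (\<rho> * g) + \<rho> * z * D"
  proof (rule add_mono)
    show "norm (cross3 \<eta> (cross3 \<eta> (cross3 \<xi> \<zeta>))) \<le> \<rho> * (\<rho> * g)"
      using order_trans[OF cr mult_left_mono[OF cr norm_ge_zero]] unfolding \<rho>_def g_def by blast
    show "\<bar>\<eta> \<bullet> \<zeta>\<bar> * D \<le> \<rho> * z * D"
      using Cauchy_Schwarz_ineq2[of \<eta> \<zeta>] unfolding \<rho>_def z_def D_def by (intro mult_right_mono) auto
  qed
  finally have "(\<bar>m\<bar> * b)\<^sup>2 \<le> (\<rho> * (\<rho> * g) + \<rho> * z * D)\<^sup>2"
    by (intro power_mono) (auto simp: b_def)
  then have mb: "m\<^sup>2 * b\<^sup>2 \<le> 2 * \<rho> ^ 4 * g\<^sup>2 + 2 * \<rho>\<^sup>2 * z\<^sup>2 * D\<^sup>2"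
    using sum_squares_bound[of "\<rho> * (\<rho> * g)" "\<rho> * z * D"]
    by (simp add: power2_sum power_mult_distrib power4_eq_xxxx power2_eq_square algebra_simps)
  have "D\<^sup>2 * b\<^sup>2 \<le> D\<^sup>2 * (z * \<rho>)\<^sup>2"
    using cr[of \<zeta> \<eta>] unfolding b_def z_def \<rho>_def by (intro mult_left_mono power_mono) auto
  then have "r\<^sup>2 * \<rho>\<^sup>2 * b\<^sup>2 \<le> \<rho>\<^sup>2 * (2 * \<rho>\<^sup>2 * g\<^sup>2 + 3 * z\<^sup>2 * D\<^sup>2)"
    unfolding rr using mb by (simp add: power_mult_distrib power4_eq_xxxx power2_eq_square algebra_simps)
  then have "r\<^sup>2 * b\<^sup>2 \<le> 2 * \<rho>\<^sup>2 * g\<^sup>2 + 3 * z\<^sup>2 * D\<^sup>2"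
    using pos by (simp add: mult.assoc mult.left_commute[of _ "\<rho>\<^sup>2"])
  then have "b\<^sup>2 / \<rho> ^ 6 \<le> (2 * \<rho>\<^sup>2 * g\<^sup>2 + 3 * z\<^sup>2 * D\<^sup>2) / (r\<^sup>2 * \<rho> ^ 6)"
    using pos by (simp add: divide_simps mult.commute)
  moreover have "(b / \<rho> ^ 3)\<^sup>2 = b\<^sup>2 / \<rho> ^ 6" by (simp add: power_divide flip: power_mult)
  ultimately show ?thesis by (simp add: r_def \<rho>_def D_def z_def g_def b_def)
qed

text \<open>The factor \<open>1 / (|\<xi>|\<^sup>2 cos\<^sup>2 \<psi>)\<close> in the binormal term is compensated by the projection: \<open>|\<xi>| cos \<psi>\<close> is the length
  of the whole normal part of \<open>\<xi>\<close>.\<close>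

lemma dissipation_terms_bound:
  fixes \<xi> \<eta> \<nu> :: "real^3" and \<kappa> lam :: real
  assumes \<xi>0: "\<xi> \<noteq> 0" and \<eta>0: "\<eta> \<noteq> 0" and \<nu>: "norm \<nu> = 1" "\<nu> \<bullet> \<eta> = 0"
  defines "M \<equiv> ((norm (cross3 \<xi> \<eta>))\<^sup>2 / (norm \<eta>)\<^sup>2 + (2 + \<bar>lam - 1\<bar>) * \<kappa>\<^sup>2) * rho_fun lam \<xi> \<eta>"
  shows "\<bar>\<bar>\<kappa> + 1 / 2 * (\<xi> \<bullet> \<nu>)\<bar>\<^sup>2 * rho_fun lam \<xi> \<eta>\<bar> \<le> M"
    and "\<bar>(1 / 4 + (lam - 1) * (\<kappa>\<^sup>2 / ((norm \<xi>)\<^sup>2 * (cos (psi_angle \<xi> \<eta>))\<^sup>2)))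
        * (norm (line_proj (cross3 \<nu> \<eta>) \<xi>))\<^sup>2 * rho_fun lam \<xi> \<eta>\<bar> \<le> M"
proof -
  define N n B where "N = (norm (cross3 \<xi> \<eta>))\<^sup>2 / (norm \<eta>)\<^sup>2" and "n = \<xi> \<bullet> \<nu>"
    and "B = (norm (line_proj (cross3 \<nu> \<eta>) \<xi>))\<^sup>2"
  have B: "B = N - n\<^sup>2" by (simp add: B_def N_def n_def binormal_projection[OF \<nu> \<eta>0])
  have B0: "0 \<le> B" by (simp add: B_def)
  have N0: "0 \<le> N" by (simp add: N_def)
  have r\<rho>: "(norm \<xi>)\<^sup>2 * (cos (psi_angle \<xi> \<eta>))\<^sup>2 = N"
    using \<xi>0 \<eta>0 by (simp add: cos_psi_angle N_def power_divide power_mult_distrib)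
  have "(\<kappa> + 1 / 2 * n)\<^sup>2 \<le> N + (2 + \<bar>lam - 1\<bar>) * \<kappa>\<^sup>2"
  proof -
    have "(\<kappa> + 1 / 2 * n)\<^sup>2 \<le> 2 * \<kappa>\<^sup>2 + n\<^sup>2 / 2"
      using zero_le_power2[of "\<kappa> - 1 / 2 * n"] by (simp add: power2_eq_square algebra_simps)
    moreover have "n\<^sup>2 \<le> N" using B B0 by simp
    moreover have "0 \<le> \<bar>lam - 1\<bar> * \<kappa>\<^sup>2" "0 \<le> n\<^sup>2" by auto
    ultimately show ?thesis unfolding distrib_right by linarith
  qed
  then show "\<bar>\<bar>\<kappa> + 1 / 2 * (\<xi> \<bullet> \<nu>)\<bar>\<^sup>2 * rho_fun lam \<xi> \<eta>\<bar> \<le> M"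
    unfolding M_def N_def[symmetric] n_def[symmetric]
    using rho_fun_nonneg[of lam \<xi> \<eta>] by (simp add: abs_mult mult_right_mono)
  have "\<bar>(1 / 4 + (lam - 1) * (\<kappa>\<^sup>2 / N)) * B\<bar> \<le> N + (2 + \<bar>lam - 1\<bar>) * \<kappa>\<^sup>2"
  proof -
    have "\<kappa>\<^sup>2 / N * B \<le> \<kappa>\<^sup>2"
    proof (cases "N = 0")
      case False
      have "\<kappa>\<^sup>2 / N * B \<le> \<kappa>\<^sup>2 / N * N" using B N0 by (intro mult_left_mono) auto
      then show ?thesis using False by simp
    qed simp
    then have "\<bar>lam - 1\<bar> * (\<kappa>\<^sup>2 / N * B) \<le> \<bar>lam - 1\<bar> * \<kappa>\<^sup>2" by (intro mult_left_mono) auto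
    moreover have "\<bar>(1 / 4 + (lam - 1) * (\<kappa>\<^sup>2 / N)) * B\<bar> \<le> 1 / 4 * B + \<bar>lam - 1\<bar> * (\<kappa>\<^sup>2 / N * B)"
    proof -
      have "\<bar>(1 / 4 + (lam - 1) * (\<kappa>\<^sup>2 / N)) * B\<bar> = \<bar>1 / 4 * B + (lam - 1) * (\<kappa>\<^sup>2 / N * B)\<bar>"
        by (simp add: algebra_simps)
      also have "\<dots> \<le> \<bar>1 / 4 * B\<bar> + \<bar>(lam - 1) * (\<kappa>\<^sup>2 / N * B)\<bar>" by (rule abs_triangle_ineq)
      also have "\<dots> = 1 / 4 * B + \<bar>lam - 1\<bar> * (\<kappa>\<^sup>2 / N * B)" using B0 N0 by (simp add: abs_mult)
      finally show ?thesis .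
    qed
    moreover have "1 / 4 * B \<le> N" using B B0 N0 zero_le_power2[of n] by linarith
    moreover have "\<bar>lam - 1\<bar> * \<kappa>\<^sup>2 \<le> (2 + \<bar>lam - 1\<bar>) * \<kappa>\<^sup>2" by (intro mult_right_mono) auto
    ultimately show ?thesis by (meson add_mono order_trans)
  qed
  then show "\<bar>(1 / 4 + (lam - 1) * (\<kappa>\<^sup>2 / ((norm \<xi>)\<^sup>2 * (cos (psi_angle \<xi> \<eta>))\<^sup>2)))
        * (norm (line_proj (cross3 \<nu> \<eta>) \<xi>))\<^sup>2 * rho_fun lam \<xi> \<eta>\<bar> \<le> M"
    unfolding M_def N_def[symmetric] r\<rho> B_def[symmetric]
    using rho_fun_nonneg[of lam \<xi> \<eta>] by (simp add: abs_mult[of _ "rho_fun lam \<xi> \<eta>"] mult_right_mono)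
qed

section \<open>The first variation of a closed curve\<close>

text \<open>If \<open>\<xi>\<close> is parallel to \<open>\<eta>\<close>, it is orthogonal to every normal vector.\<close>

lemma dF_normal_degenerate:
  assumes \<xi>0: "\<xi> \<noteq> 0" and \<eta>0: "\<eta> \<noteq> 0" and perp: "\<eta> \<bullet> Y = 0" and G0: "cross3 \<xi> \<eta> = 0"
  shows "dF lam \<xi> \<eta> Y Y' = a_fun lam (norm \<xi>) * (cos_integral lam (psi_angle \<xi> \<eta>) * ((\<xi> \<bullet> Y') / norm \<xi>))"
    and "dF lam \<xi> \<eta> 0 Y = 0" and "\<xi> \<bullet> Y = 0"
proof -
  have "cross3 \<xi> \<eta> \<bullet> cross3 Y \<eta> = (\<xi> \<bullet> Y) * (\<eta> \<bullet> \<eta>)"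
    using perp by (simp add: dot_cross inner_commute)
  then show "\<xi> \<bullet> Y = 0" using \<eta>0 by (simp add: G0)
  then show "dF lam \<xi> \<eta> Y Y' = a_fun lam (norm \<xi>) * (cos_integral lam (psi_angle \<xi> \<eta>) * ((\<xi> \<bullet> Y') / norm \<xi>))"
    and "dF lam \<xi> \<eta> 0 Y = 0"
    using perp by (simp_all add: dF_def d_radial_speed_def cos_root_psi_eq_0[OF \<xi>0 \<eta>0 G0] inner_commute)
qed

lemma periodic_vector_derivative:
  fixes f f' :: "real \<Rightarrow> 'a::real_normed_vector"
  assumes per: "\<And>x. f (x + L) = f x" and der: "\<And>x. (f has_vector_derivative f' x) (at x)"
  shows "f' (x + L) = f' x"
proof -
  have "((f \<circ> (\<lambda>x. x + L)) has_vector_derivative 1 *\<^sub>R f' (x + L)) (at x)"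
    by (rule vector_diff_chain_at) (auto intro!: derivative_eq_intros der)
  then have "(f has_vector_derivative f' (x + L)) (at x)"
    by (simp add: o_def per)
  then show ?thesis using der vector_derivative_unique_at by blast
qed

text \<open>One time slice of the flow. Only the position \<open>c\<close>, its first three derivatives and the velocity \<open>X\<close>
  with its derivative \<open>X'\<close> along the curve enter the first variation. Three derivatives of
  \<open>c\<close> are used because \<open>c \<times> c'\<close> has to be \<open>C\<^sup>2\<close>.\<close>

locale closed_curve_flow =
  fixes lam :: real and c e dd ddd X X' :: "real \<Rightarrow> real^3" and \<nu> :: "real \<Rightarrow> real^3"
  assumes lam: "0 < lam"
    and c: "\<And>x. (c has_vector_derivative e x) (at x)"
    and e: "\<And>x. (e has_vector_derivative dd x) (at x)"
    and dd: "\<And>x. (dd has_vector_derivative ddd x) (at x)"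
    and ddd: "continuous_on UNIV ddd"
    and X: "\<And>x. (X has_vector_derivative X' x) (at x)"
    and X': "continuous_on UNIV X'"
    and c_periodic: "\<And>x. c (x + 2 * pi) = c x"
    and c0: "\<And>x. c x \<noteq> 0" and e0: "\<And>x. e x \<noteq> 0"
    and flow: "\<And>x. X x = (1 / 2) *\<^sub>R c x + curvature_vector (e x) (dd x)"
    and \<nu>: "unit_normal_field c \<nu>"
begin

abbreviation S where "S \<equiv> {0..2*pi}"

lemma curve_d_eq: "curve_d c = e" and curve_dd_eq: "curve_dd c = dd"
proof -
  show "curve_d c = e" using c by (auto simp: curve_d_def vector_derivative_at)
  then show "curve_dd c = dd" using e by (auto simp: curve_dd_def curve_d_def vector_derivative_at)
qed

lemma continuous: "continuous_on A c" "continuous_on A e" "continuous_on A dd" "continuous_on A X"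
  using has_vector_derivative_continuous[OF c] has_vector_derivative_continuous[OF e]
    has_vector_derivative_continuous[OF dd] has_vector_derivative_continuous[OF X]
  by (auto intro: continuous_at_imp_continuous_on)

lemma continuous': "continuous_on A ddd" "continuous_on A X'"
  using ddd X' by (auto intro: continuous_on_subset)

lemma periodic: "e (x + 2 * pi) = e x" "dd (x + 2 * pi) = dd x" "X (x + 2 * pi) = X x"
proof -
  show 1: "e (x + 2 * pi) = e x" for x by (rule periodic_vector_derivative[OF c_periodic c])
  show 2: "dd (x + 2 * pi) = dd x" for x by (rule periodic_vector_derivative[OF 1 e])
  show "X (x + 2 * pi) = X x" by (simp add: flow 1 2 c_periodic)
qed

text \<open>\<open>\<phi> e\<close> is the tangential part of the velocity \<open>X\<close>, and \<open>Y\<close> below is the normal part; \<open>\<phi>'\<close> and \<open>Y'\<close> are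
  their derivatives along the curve.\<close>

definition \<phi> where "\<phi> x = (c x \<bullet> e x) / (2 * (e x \<bullet> e x))"
definition \<phi>' where "\<phi>' x = ((c x \<bullet> dd x + e x \<bullet> e x) * (2 * (e x \<bullet> e x)) - (c x \<bullet> e x) * (4 * (e x \<bullet> dd x)))
    / ((2 * (e x \<bullet> e x)) * (2 * (e x \<bullet> e x)))"
definition Y where "Y x = X x - \<phi> x *\<^sub>R e x"
definition Y' where "Y' x = X' x - (\<phi>' x *\<^sub>R e x + \<phi> x *\<^sub>R dd x)"

lemma \<phi>_derivative: "(\<phi> has_real_derivative \<phi>' x) (at x)"
  unfolding \<phi>_def[abs_def] \<phi>'_def
  by (rule DERIV_cong[OF DERIV_divide[OF inner_has_real_derivative[OF c e]
        DERIV_cmult[OF inner_has_real_derivative[OF e e]]]])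
     (use e0 in \<open>auto simp: inner_commute\<close>)

lemma Y_derivative: "(Y has_vector_derivative Y' x) (at x)"
  unfolding Y_def[abs_def] Y'_def
  using has_vector_derivative_diff[OF X has_vector_derivative_scaleR[OF \<phi>_derivative e]]
  by (simp add: add.commute)

lemma continuous_\<phi>: "continuous_on A \<phi>" "continuous_on A \<phi>'"
  unfolding \<phi>_def[abs_def] \<phi>'_def[abs_def] using e0 by (auto intro!: continuous_intros continuous)

lemma continuous_Y: "continuous_on A Y" "continuous_on A Y'"
  unfolding Y_def[abs_def] Y'_def[abs_def] by (auto intro!: continuous_intros continuous continuous' continuous_\<phi>)

lemma Y_eq: "Y x = (1 / 2) *\<^sub>R (c x - ((c x \<bullet> e x) / (norm (e x))\<^sup>2) *\<^sub>R e x) + curvature_vector (e x) (dd x)"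
  by (simp add: Y_def flow \<phi>_def power2_norm_eq_inner scaleR_diff_right)

lemma Y_perp: "e x \<bullet> Y x = 0"
  using e0[of x] dot_cross_self(1)[of "e x"]
  by (simp add: Y_eq inner_add_right inner_diff_right curvature_vector_def power2_norm_eq_inner inner_commute)

lemma normal_at:
  assumes "x \<in> S"
  shows "norm (\<nu> x) = 1" "\<nu> x \<bullet> e x = 0" "curvature_vector (e x) (dd x) = curvature c x *\<^sub>R \<nu> x"
  using unit_normal_fieldD[OF \<nu> assms] e0 by (auto simp: curve_d_eq curve_dd_eq)

lemma terms_degenerate:
  assumes "cross3 (c x) (e x) = 0"
  shows "normal_term lam c \<nu> x = 0" "binormal_term lam c \<nu> x = 0"
  using rho_fun_degenerate[OF lam c0 e0 assms]
  by (simp_all add: normal_term_def binormal_term_def curve_d_eq)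

lemma curvature_eq: "curvature c x = norm (cross3 (dd x) (e x)) / norm (e x) ^ 3"
  by (simp add: curvature_def curve_d_eq curve_dd_eq)

definition dominating where
  "dominating x = ((norm (cross3 (c x) (e x)))\<^sup>2 / (norm (e x))\<^sup>2 + (2 + \<bar>lam - 1\<bar>) * (curvature c x)\<^sup>2)
     * rho_fun lam (c x) (e x)"

lemma terms_le_dominating:
  assumes "x \<in> S"
  shows "norm (normal_term lam c \<nu> x) \<le> dominating x" "norm (binormal_term lam c \<nu> x) \<le> dominating x"
  using dissipation_terms_bound[where \<kappa> = "curvature c x" and lam = lam, OF c0 e0 normal_at(1,2)[OF assms]]
  by (auto simp: normal_term_def binormal_term_def dominating_def curve_d_eq)

text \<open>The bound is \<open>W\<^sub>1 |G'|\<^sup>2 |G|\<^sup>p + W\<^sub>2 |G|\<^sup>p\<^sup>+\<^sup>2\<close> with continuous \<open>W\<^sub>1\<close>, \<open>W\<^sub>2\<close> and \<open>p = 1/\<lambda> - 1 > -1\<close>.\<close>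

lemma dominating_integrable: "\<exists>g. g integrable_on S \<and> (\<forall>x\<in>S. dominating x \<le> g x)"
proof -
  define D g' where "D x = norm (cross3 (c x) (e x))" and "g' x = norm (cross3 (c x) (dd x))" for x
  define p where "p = 1 / lam - 1"
  have p: "-1 < p" using lam by (simp add: p_def)
  define A where "A x = a_fun lam (norm (c x)) * norm (e x) * (norm (c x) * norm (e x)) powr (1 - 1 / lam)" for x
  define W1 W2 where "W1 x = A x * ((2 + \<bar>lam - 1\<bar>) * (2 * (norm (e x))\<^sup>2 / ((norm (c x))\<^sup>2 * norm (e x) ^ 6)))"
    and "W2 x = A x * (1 / (norm (e x))\<^sup>2 + (2 + \<bar>lam - 1\<bar>) * (3 * (norm (dd x))\<^sup>2 / ((norm (c x))\<^sup>2 * norm (e x) ^ 6)))" for x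
  have A: "continuous_on S A"
    unfolding A_def[abs_def] using c0 e0
    by (intro continuous_on_mult continuous_on_a_fun continuous continuous_on_powr continuous_on_norm continuous_on_const) auto
  have A0: "0 \<le> A x" for x by (simp add: A_def a_fun_def)
  have W: "continuous_on S W1" "continuous_on S W2"
    unfolding W1_def[abs_def] W2_def[abs_def] using c0 e0
    by (intro continuous_on_mult[OF A] continuous_intros continuous; simp)+
  have "\<exists>M. \<forall>x\<in>S. norm (W1 x) \<le> M"
    using compact_imp_bounded[OF compact_continuous_image[OF W(1) compact_Icc]] unfolding bounded_iff by blast
  then obtain M where M: "\<And>x. x \<in> S \<Longrightarrow> norm (W1 x) \<le> M" by blast
  have D'd: "((\<lambda>x. cross3 (c x) (e x)) has_vector_derivative cross3 (c x) (dd x)) (at x)" for x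
    using cross3_has_vector_derivative[OF c e] by simp
  have D''d: "((\<lambda>x. cross3 (c x) (dd x)) has_vector_derivative cross3 (c x) (ddd x) + cross3 (e x) (dd x)) (at x)" for x
    by (rule cross3_has_vector_derivative[OF c dd])
  have i: "(\<lambda>x. (g' x)\<^sup>2 * D x powr p) integrable_on S"
    unfolding g'_def D_def
    by (rule integrable_weighted_derivative_square[OF _ p D'd D''d])
       (auto intro!: continuous_intros continuous_on_cross continuous continuous')
  have D2: "continuous_on S (\<lambda>x. D x powr (2 + p))"
    unfolding D_def using p by (intro continuous_on_powr' continuous_intros continuous_on_cross continuous) auto
  show ?thesis
  proof (intro exI conjI ballI)
    show "(\<lambda>x. M * ((g' x)\<^sup>2 * D x powr p) + W2 x * D x powr (2 + p)) integrable_on S"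
      by (intro integrable_add integrable_on_mult_right i integrable_continuous_interval[OF continuous_on_mult[OF W(2) D2]])
    fix x assume x: "x \<in> S"
    have \<rho>: "rho_fun lam (c x) (e x) = A x * D x powr p"
      by (simp add: rho_fun_eq[OF lam c0 e0] A_def D_def p_def)
    have "(curvature c x)\<^sup>2 \<le> (2 * (norm (e x))\<^sup>2 * (g' x)\<^sup>2 + 3 * (norm (dd x))\<^sup>2 * (D x)\<^sup>2) / ((norm (c x))\<^sup>2 * norm (e x) ^ 6)"
      unfolding curvature_eq g'_def D_def by (rule curvature_bound[OF c0 e0])
    then have "(2 + \<bar>lam - 1\<bar>) * (curvature c x)\<^sup>2 \<le> (2 + \<bar>lam - 1\<bar>) * ((2 * (norm (e x))\<^sup>2 * (g' x)\<^sup>2 + 3 * (norm (dd x))\<^sup>2 * (D x)\<^sup>2) / ((norm (c x))\<^sup>2 * norm (e x) ^ 6))"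
      by (rule mult_left_mono) simp
    then have "dominating x \<le> ((D x)\<^sup>2 / (norm (e x))\<^sup>2 + (2 + \<bar>lam - 1\<bar>) * ((2 * (norm (e x))\<^sup>2 * (g' x)\<^sup>2 + 3 * (norm (dd x))\<^sup>2 * (D x)\<^sup>2) / ((norm (c x))\<^sup>2 * norm (e x) ^ 6))) * (A x * D x powr p)"
      unfolding dominating_def \<rho>[symmetric] D_def[symmetric] by (intro mult_right_mono rho_fun_nonneg add_left_mono)
    also have "\<dots> = W1 x * ((g' x)\<^sup>2 * D x powr p) + W2 x * ((D x)\<^sup>2 * D x powr p)"
      by (simp add: W1_def W2_def add_divide_distrib algebra_simps)
    also have "(D x)\<^sup>2 * D x powr p = D x powr (2 + p)"
      by (cases "D x = 0") (auto simp: powr_add D_def)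
    also have "W1 x * ((g' x)\<^sup>2 * D x powr p) \<le> M * ((g' x)\<^sup>2 * D x powr p)"
      using M[OF x] by (intro mult_right_mono) auto
    finally show "dominating x \<le> M * ((g' x)\<^sup>2 * D x powr p) + W2 x * D x powr (2 + p)" by simp
  qed
qed

text \<open>The only ingredient that is not built from continuous functions is \<open>\<nu>\<close>, measurable by
  hypothesis. The binormal term is first rewritten so that \<open>\<nu>\<close> enters through a single inner product.\<close>

lemma terms_measurable:
  "normal_term lam c \<nu> \<in> borel_measurable (lebesgue_on S)" "binormal_term lam c \<nu> \<in> borel_measurable (lebesgue_on S)"
proof -
  have cm: "f \<in> borel_measurable (lebesgue_on S)" if "continuous_on S f" for f :: "real \<Rightarrow> 'b::euclidean_space"
    using that by (auto intro: continuous_imp_measurable_on_sets_lebesgue)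
  have [measurable]: "\<nu> \<in> borel_measurable (lebesgue_on S)"
    using \<nu> by (simp add: unit_normal_field_def)
  have [measurable]: "c \<in> borel_measurable (lebesgue_on S)" "e \<in> borel_measurable (lebesgue_on S)"
    "(\<lambda>x. cross3 (c x) (e x)) \<in> borel_measurable (lebesgue_on S)"
    "(\<lambda>x. cross3 (e x) (c x)) \<in> borel_measurable (lebesgue_on S)"
    by (intro cm continuous continuous_on_cross)+
  have [measurable]: "(\<lambda>x. curvature c x) \<in> borel_measurable (lebesgue_on S)"
    unfolding curvature_eq using e0 by (intro cm continuous_intros continuous continuous_on_cross) auto
  have [measurable]: "(\<lambda>x. a_fun lam (norm (c x))) \<in> borel_measurable (lebesgue_on S)"
    using c0 by (intro cm continuous_on_a_fun continuous)
  have [measurable]: "(\<lambda>x. rho_fun lam (c x) (e x)) \<in> borel_measurable (lebesgue_on S)"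
    unfolding rho_fun_eq[OF lam c0 e0] by measurable
  show "normal_term lam c \<nu> \<in> borel_measurable (lebesgue_on S)"
    unfolding normal_term_def[abs_def] curve_d_eq by measurable
  define B where "B x = (1 / 4 + (lam - 1) * ((curvature c x)\<^sup>2
        / ((norm (c x))\<^sup>2 * (norm (cross3 (c x) (e x)) / (norm (c x) * norm (e x)))\<^sup>2)))
      * ((\<nu> x \<bullet> cross3 (e x) (c x))\<^sup>2 / (norm (e x))\<^sup>2) * rho_fun lam (c x) (e x)" for x
  have "B \<in> borel_measurable (lebesgue_on S)"
    unfolding B_def[abs_def] by measurable
  moreover have "B x = binormal_term lam c \<nu> x"
    if "x \<in> space (lebesgue_on S)" for x
  proof -
    have x: "x \<in> S" using that by simp
    have "c x \<bullet> cross3 (\<nu> x) (e x) = \<nu> x \<bullet> cross3 (e x) (c x)"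
      by (metis cross_triple inner_commute)
    then show ?thesis
      by (simp add: B_def binormal_term_def curve_d_eq norm_line_proj_square cross_unit_normal(1)[OF normal_at(1,2)[OF x]]
          cos_psi_angle[OF c0 e0])
  qed
  ultimately show "binormal_term lam c \<nu> \<in> borel_measurable (lebesgue_on S)"
    using measurable_cong[of "lebesgue_on S" B "binormal_term lam c \<nu>" borel] by blast
qed

lemma terms_integrable:
  "normal_term lam c \<nu> absolutely_integrable_on S" "binormal_term lam c \<nu> absolutely_integrable_on S"
proof -
  obtain g where g: "g integrable_on S" "\<And>x. x \<in> S \<Longrightarrow> dominating x \<le> g x"
    using dominating_integrable by blast
  show "normal_term lam c \<nu> absolutely_integrable_on S"
    by (rule measurable_bounded_by_integrable_imp_absolutely_integrable[OF terms_measurable(1) _ g(1)])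
       (auto intro: order_trans[OF terms_le_dominating(1) g(2)] simp del: real_norm_def)
  show "binormal_term lam c \<nu> absolutely_integrable_on S"
    by (rule measurable_bounded_by_integrable_imp_absolutely_integrable[OF terms_measurable(2) _ g(1)])
       (auto intro: order_trans[OF terms_le_dominating(2) g(2)] simp del: real_norm_def)
qed

lemma F_absolutely_integrable: "(\<lambda>x. F_fun lam (c x) (e x)) absolutely_integrable_on S"
  using continuous_on_F_fun[OF lam continuous(1,2)] c0 e0 by (intro absolutely_integrable_continuous_real) auto

lemma continuous_dF:
  assumes "continuous_on A V" "continuous_on A W"
  shows "continuous_on A (\<lambda>x. dF lam (c x) (e x) (V x) (W x))"
  by (rule continuous_on_dF[OF lam continuous(1,2) c0 e0 assms])

lemma integral_tangential: "((\<lambda>x. dF lam (c x) (e x) (\<phi> x *\<^sub>R e x) (\<phi>' x *\<^sub>R e x + \<phi> x *\<^sub>R dd x)) has_integral 0) S"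
proof -
  have "((\<lambda>x. \<phi> x * F_fun lam (c x) (e x)) has_vector_derivative
      dF lam (c x) (e x) (\<phi> x *\<^sub>R e x) (\<phi>' x *\<^sub>R e x + \<phi> x *\<^sub>R dd x)) (at x within S)" for x
  proof -
    have "((\<lambda>x. \<phi> x * F_fun lam (c x) (e x)) has_real_derivative
      \<phi> x * dF lam (c x) (e x) (e x) (dd x) + \<phi>' x * F_fun lam (c x) (e x)) (at x)"
      by (rule DERIV_mult'[OF \<phi>_derivative F_fun_has_derivative_along[OF lam c e c0 e0]])
    then show ?thesis
      by (simp add: dF_tangential[OF c0 e0] has_real_derivative_iff_has_vector_derivative has_vector_derivative_at_within)
  qed
  then have "((\<lambda>x. dF lam (c x) (e x) (\<phi> x *\<^sub>R e x) (\<phi>' x *\<^sub>R e x + \<phi> x *\<^sub>R dd x)) has_integral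
      \<phi> (2*pi) * F_fun lam (c (2*pi)) (e (2*pi)) - \<phi> 0 * F_fun lam (c 0) (e 0)) S"
    by (intro fundamental_theorem_of_calculus) auto
  moreover have "c (2*pi) = c 0" "e (2*pi) = e 0"
    using c_periodic[of 0] periodic(1)[of 0] by simp_all
  ultimately show ?thesis by (simp add: \<phi>_def)
qed

text \<open>Off \<open>{c \<times> e = 0}\<close> the integrand is the derivative of the flux. On that set both terms of the dissipation
  are zero, and \<open>dF(Y, Y')\<close> is a multiple of \<open>\<langle>c, Y'\<rangle>\<close>, the derivative of the
  function \<open>\<langle>c, Y\<rangle>\<close>, which vanishes on the set; so the integrand is zero there up to a null set.\<close>

lemma integral_normal_variation:
  "integral S (\<lambda>x. dF lam (c x) (e x) (Y x) (Y' x) + (normal_term lam c \<nu> x + binormal_term lam c \<nu> x)) = 0"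
    (is "integral S ?E = 0")
proof -
  define Z where "Z = {x. cross3 (c x) (e x) = 0}"
  show ?thesis
  proof (rule integral_derivative_off_zero_set[where Z = Z and h = "\<lambda>x. dF lam (c x) (e x) 0 (Y x)"])
    have "Y (2*pi) = Y 0" "c (2*pi) = c 0" "e (2*pi) = e 0"
      using c_periodic[of 0] periodic[of 0] by (simp_all add: Y_def \<phi>_def)
    then show "dF lam (c 0) (e 0) 0 (Y 0) = dF lam (c (2*pi)) (e (2*pi)) 0 (Y (2*pi))" by simp
    show "isCont (\<lambda>x. dF lam (c x) (e x) 0 (Y x)) x" for x
      using continuous_dF[OF continuous_on_const continuous_Y(1), of UNIV] by (simp add: continuous_on_eq_continuous_at)
    show "((\<lambda>x. dF lam (c x) (e x) 0 (Y x)) has_real_derivative ?E x) (at x)" if x: "x \<in> S" and "x \<notin> Z" for x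
    proof -
      have G0: "cross3 (c x) (e x) \<noteq> 0" using that by (simp add: Z_def)
      have "variation_density lam (c x) (e x) (dd x) (Y x) = normal_term lam c \<nu> x + binormal_term lam c \<nu> x"
        using variation_density_eq[OF lam c0 e0 G0 normal_at[OF x] Y_eq[of x, unfolded normal_at(3)[OF x]]]
        by (simp add: normal_term_def binormal_term_def curve_d_eq)
      then show ?thesis
        using normal_flux_derivative[OF lam c e Y_derivative c0 e0 Y_perp G0] by simp
    qed
    show "dF lam (c x) (e x) 0 (Y x) = 0" if "x \<in> Z" for x
      using dF_normal_degenerate(2)[OF c0 e0 Y_perp] that by (simp add: Z_def)
    show "negligible {x \<in> S. x \<in> Z \<and> ?E x \<noteq> 0}"
    proof (rule negligible_simple_zeros[where f = "\<lambda>x. c x \<bullet> Y x"])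
      fix x assume x: "x \<in> {x \<in> S. x \<in> Z \<and> ?E x \<noteq> 0}"
      then have G0: "cross3 (c x) (e x) = 0" by (simp add: Z_def)
      show "c x \<bullet> Y x = 0" by (rule dF_normal_degenerate(3)[OF c0 e0 Y_perp G0])
      have "c x \<bullet> Y' x \<noteq> 0"
        using x dF_normal_degenerate(1)[OF c0 e0 Y_perp G0, of lam "Y' x"] terms_degenerate[OF G0] by auto
      moreover have "((\<lambda>x. c x \<bullet> Y x) has_vector_derivative c x \<bullet> Y' x) (at x)"
        using inner_has_real_derivative[OF c Y_derivative, of x] Y_perp
        by (simp add: has_real_derivative_iff_has_vector_derivative)
      ultimately show "\<exists>d. d \<noteq> 0 \<and> ((\<lambda>x. c x \<bullet> Y x) has_vector_derivative d) (at x)" by blast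
    qed
    show "?E absolutely_integrable_on S"
      by (intro set_integral_add(1) terms_integrable
          absolutely_integrable_continuous_real[OF continuous_dF[OF continuous_Y]])
  qed simp
qed

lemma first_variation_integral:
  "integral S (\<lambda>x. dF lam (c x) (e x) (X x) (X' x))
     = - integral S (normal_term lam c \<nu>) - integral S (binormal_term lam c \<nu>)"
proof -
  note ni = terms_integrable[THEN set_lebesgue_integral_eq_integral(1)]
  have iY: "(\<lambda>x. dF lam (c x) (e x) (Y x) (Y' x)) integrable_on S"
    by (intro integrable_continuous_interval continuous_dF continuous_Y)
  have "dF lam (c x) (e x) (X x) (X' x) = dF lam (c x) (e x) (Y x) (Y' x)
      + dF lam (c x) (e x) (\<phi> x *\<^sub>R e x) (\<phi>' x *\<^sub>R e x + \<phi> x *\<^sub>R dd x)" for x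
    by (simp add: Y_def Y'_def flip: dF_add)
  then have "integral S (\<lambda>x. dF lam (c x) (e x) (X x) (X' x)) = integral S (\<lambda>x. dF lam (c x) (e x) (Y x) (Y' x))"
    using integral_tangential by (simp add: integral_add[OF iY has_integral_integrable] integral_unique)
  also have "\<dots> = - integral S (normal_term lam c \<nu>) - integral S (binormal_term lam c \<nu>)"
    using integral_normal_variation
    by (simp add: integral_add[OF iY integrable_add[OF ni]] integral_add[OF ni])
  finally show ?thesis .
qed

end

lemma smooth_map_partial:
  assumes "smooth_map_on S f"
  shows "smooth_map_on S (\<lambda>p. frechet_derivative f (at p) v)"
    and "p \<in> S \<Longrightarrow> (f has_derivative frechet_derivative f (at p)) (at p)"
    and "continuous_on S f"
proof -
  have *: "Ck_on k S f" for k using assms by (simp add: smooth_map_on_def)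
  show "smooth_map_on S (\<lambda>p. frechet_derivative f (at p) v)"
    using *[of "Suc k" for k] by (simp add: smooth_map_on_def)
  show "p \<in> S \<Longrightarrow> (f has_derivative frechet_derivative f (at p)) (at p)"
    using *[of 1] by (simp add: frechet_derivative_works)
  show "continuous_on S f" using *[of 0] by simp
qed

lemma smooth_map_slices:
  fixes f :: "real \<times> real \<Rightarrow> 'a::real_normed_vector"
  assumes "smooth_map_on S f" "(s, x) \<in> S"
  shows "((\<lambda>y. f (s, y)) has_vector_derivative frechet_derivative f (at (s, x)) (0, 1)) (at x)"
    and "((\<lambda>t. f (t, x)) has_vector_derivative frechet_derivative f (at (s, x)) (1, 0)) (at s)"
proof -
  note d = smooth_map_partial(2)[OF assms]
  have l: "frechet_derivative f (at (s, x)) (h *\<^sub>R v) = h *\<^sub>R frechet_derivative f (at (s, x)) v" for h v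
    using linear_cmul[OF has_derivative_linear[OF d]] by blast
  have l01: "frechet_derivative f (at (s, x)) (0, h) = h *\<^sub>R frechet_derivative f (at (s, x)) (0, 1)" for h
    using l[of h "(0, 1)"] by simp
  have l10: "frechet_derivative f (at (s, x)) (h, 0) = h *\<^sub>R frechet_derivative f (at (s, x)) (1, 0)" for h
    using l[of h "(1, 0)"] by simp
  have "((\<lambda>y. (s, y)) has_derivative (\<lambda>h. (0, h))) (at x)"
    by (rule has_derivative_Pair[OF has_derivative_const has_derivative_ident])
  from has_derivative_compose[OF this d]
  show "((\<lambda>y. f (s, y)) has_vector_derivative frechet_derivative f (at (s, x)) (0, 1)) (at x)"
    unfolding has_vector_derivative_def
    by (rule has_derivative_eq_rhs) (rule ext, rule l01)
  have "((\<lambda>t. (t, x)) has_derivative (\<lambda>h. (h, 0))) (at s)"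
    by (rule has_derivative_Pair[OF has_derivative_ident has_derivative_const])
  from has_derivative_compose[OF this d]
  show "((\<lambda>t. f (t, x)) has_vector_derivative frechet_derivative f (at (s, x)) (1, 0)) (at s)"
    unfolding has_vector_derivative_def
    by (rule has_derivative_eq_rhs) (rule ext, rule l10)
qed

theorem theorem2:
  fixes T lam \<tau> :: real and \<gamma> :: "real \<Rightarrow> real \<Rightarrow> real^3" and \<nu> :: "real \<Rightarrow> real^3"
  assumes "0 < T"
    and "rescaled_csf T \<gamma>"
    and "0 < lam"
    and "- ln T < \<tau>"
    and "\<And>x. \<gamma> \<tau> x \<noteq> 0"
    and "unit_normal_field (\<gamma> \<tau>) \<nu>"
  shows "(\<lambda>x. F_fun lam (\<gamma> \<tau> x) (curve_d (\<gamma> \<tau>) x)) absolutely_integrable_on {0..2*pi} \<and>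
         normal_term lam (\<gamma> \<tau>) \<nu> absolutely_integrable_on {0..2*pi} \<and>
         binormal_term lam (\<gamma> \<tau>) \<nu> absolutely_integrable_on {0..2*pi} \<and>
         ((\<lambda>s. integral {0..2*pi} (\<lambda>x. F_fun lam (\<gamma> s x) (curve_d (\<gamma> s) x)))
            has_real_derivative
              (- integral {0..2*pi} (normal_term lam (\<gamma> \<tau>) \<nu>)
               - integral {0..2*pi} (binormal_term lam (\<gamma> \<tau>) \<nu>))) (at \<tau>)"
proof -
  define \<alpha> where "\<alpha> = - ln T"
  define dom where "dom = {\<alpha><..} \<times> (UNIV :: real set)"
  define f where "f = (\<lambda>(s, x). \<gamma> s x)"
  define fx where "fx p = frechet_derivative f (at p) (0, 1)" for p
  define fxx where "fxx p = frechet_derivative fx (at p) (0, 1)" for p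
  define fxxx where "fxxx p = frechet_derivative fxx (at p) (0, 1)" for p
  define fs where "fs p = frechet_derivative f (at p) (1, 0)" for p
  define fxs where "fxs p = frechet_derivative fx (at p) (1, 0)" for p
  have sm: "smooth_map_on dom f" and per: "\<And>s x. \<alpha> < s \<Longrightarrow> \<gamma> s (x + 2 * pi) = \<gamma> s x"
    and reg: "\<And>s x. \<alpha> < s \<Longrightarrow> curve_d (\<gamma> s) x \<noteq> 0"
    and pde: "\<And>s x. \<alpha> < s \<Longrightarrow> ((\<lambda>s. \<gamma> s x) has_vector_derivative
          (1 / 2) *\<^sub>R \<gamma> s x + curvature_vector (curve_d (\<gamma> s) x) (curve_dd (\<gamma> s) x)) (at s)"
    using assms(2) by (auto simp: rescaled_csf_def dom_def f_def \<alpha>_def curvature_vector_def)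
  have smx: "smooth_map_on dom fx" "smooth_map_on dom fxx" "smooth_map_on dom fxxx" "smooth_map_on dom fs" "smooth_map_on dom fxs"
    unfolding fx_def[abs_def] fxx_def[abs_def] fxxx_def[abs_def] fs_def[abs_def] fxs_def[abs_def]
    by (intro smooth_map_partial(1) sm)+
  have dx: "(\<gamma> s has_vector_derivative fx (s, x)) (at x)"
    and dxx: "((\<lambda>y. fx (s, y)) has_vector_derivative fxx (s, x)) (at x)"
    and dxxx: "((\<lambda>y. fxx (s, y)) has_vector_derivative fxxx (s, x)) (at x)"
    and ds: "((\<lambda>s. \<gamma> s x) has_vector_derivative fs (s, x)) (at s)"
    and dxs: "((\<lambda>s. fx (s, x)) has_vector_derivative fxs (s, x)) (at s)" if "\<alpha> < s" for s x
  proof -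
    have p: "(s, x) \<in> dom" using that by (simp add: dom_def)
    show "(\<gamma> s has_vector_derivative fx (s, x)) (at x)" "((\<lambda>s. \<gamma> s x) has_vector_derivative fs (s, x)) (at s)"
      using smooth_map_slices[OF sm p] by (simp_all add: f_def fx_def fs_def)
    show "((\<lambda>y. fx (s, y)) has_vector_derivative fxx (s, x)) (at x)" "((\<lambda>s. fx (s, x)) has_vector_derivative fxs (s, x)) (at s)"
      using smooth_map_slices[OF smx(1) p] by (simp_all add: fxx_def fxs_def)
    show "((\<lambda>y. fxx (s, y)) has_vector_derivative fxxx (s, x)) (at x)"
      using smooth_map_slices[OF smx(2) p] by (simp add: fxxx_def)
  qed
  have cd: "curve_d (\<gamma> s) = (\<lambda>x. fx (s, x))" and cdd: "curve_dd (\<gamma> s) = (\<lambda>x. fxx (s, x))" if "\<alpha> < s" for s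
  proof -
    show *: "curve_d (\<gamma> s) = (\<lambda>x. fx (s, x))"
      using dx[OF that] by (auto simp: curve_d_def vector_derivative_at)
    show "curve_dd (\<gamma> s) = (\<lambda>x. fxx (s, x))"
      unfolding curve_dd_def * using dxx[OF that] by (auto simp: curve_d_def vector_derivative_at)
  qed
  note cont = smooth_map_partial(3)[OF sm] smx[THEN smooth_map_partial(3)]
  have slice: "continuous_on UNIV (\<lambda>x. g (s, x))" if "continuous_on dom g" "\<alpha> < s" for g :: "real \<times> real \<Rightarrow> real^3" and s
    by (rule continuous_on_compose2[OF that(1)]) (use that(2) in \<open>auto simp: dom_def intro!: continuous_intros\<close>)
  have \<tau>: "\<alpha> < \<tau>" using assms(4) by (simp add: \<alpha>_def)
  have mixed: "((\<lambda>x. fs (\<tau>, x)) has_vector_derivative fxs (\<tau>, x)) (at x)" for x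
    by (rule mixed_partials_commute[where \<gamma> = \<gamma> and cx = "\<lambda>s x. fx (s, x)" and \<alpha> = \<alpha>])
       (use dx ds dxs slice[OF cont(2)] cont(6) \<tau> in \<open>auto simp: dom_def case_prod_eta\<close>)
  have flow: "fs (\<tau>, x) = (1 / 2) *\<^sub>R \<gamma> \<tau> x + curvature_vector (fx (\<tau>, x)) (fxx (\<tau>, x))" for x
    using vector_derivative_unique_at[OF ds[OF \<tau>] pde[OF \<tau>]] by (simp add: cd cdd \<tau>)
  interpret closed_curve_flow lam "\<gamma> \<tau>" "\<lambda>x. fx (\<tau>, x)" "\<lambda>x. fxx (\<tau>, x)" "\<lambda>x. fxxx (\<tau>, x)"
      "\<lambda>x. fs (\<tau>, x)" "\<lambda>x. fxs (\<tau>, x)" \<nu>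
    using assms dx[OF \<tau>] dxx[OF \<tau>] dxxx[OF \<tau>] slice[OF cont(4) \<tau>] slice[OF cont(6) \<tau>] mixed per[OF \<tau>] reg[OF \<tau>] flow
    by unfold_locales (auto simp: cd[OF \<tau>])
  \<comment> \<open>\<open>\<gamma> \<tau>\<close> stays away from the origin by compactness, hence so does \<open>\<gamma> s\<close> for \<open>s\<close> near \<open>\<tau>\<close>; otherwise \<open>F\<close>
  could not be differentiated under the integral\<close>
  obtain \<delta> where \<delta>: "\<delta> > 0" "\<And>s x. s \<in> ball \<tau> \<delta> \<Longrightarrow> x \<in> {0..2*pi} \<Longrightarrow> \<alpha> < s \<and> \<gamma> s x \<noteq> 0"
  proof -
    have "\<exists>x0\<in>{0..2*pi}. \<forall>x\<in>{0..2*pi}. norm (\<gamma> \<tau> x0) \<le> norm (\<gamma> \<tau> x)"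
      by (intro continuous_attains_inf continuous_on_norm continuous(1)) auto
    then obtain x0 where x0: "\<And>x. x \<in> {0..2*pi} \<Longrightarrow> norm (\<gamma> \<tau> x0) \<le> norm (\<gamma> \<tau> x)" by blast
    have "continuous_on ({\<alpha><..} \<times> {0..2*pi}) f"
      by (rule continuous_on_subset[OF cont(1)]) (auto simp: dom_def)
    then obtain U where U: "\<tau> \<in> U" "open U"
      "\<forall>s\<in>U \<inter> {\<alpha><..}. \<forall>x\<in>{0..2*pi}. dist (f (s, x)) (f (\<tau>, x)) \<le> norm (\<gamma> \<tau> x0) / 2"
      by (rule continuous_on_prod_compactE[where e = "norm (\<gamma> \<tau> x0) / 2" and ?x0.0 = \<tau>]) (use assms(5) \<tau> in auto)
    have "open (U \<inter> {\<alpha><..})" "\<tau> \<in> U \<inter> {\<alpha><..}" using U \<tau> by auto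
    then obtain \<delta> where d: "\<delta> > 0" "ball \<tau> \<delta> \<subseteq> U \<inter> {\<alpha><..}" by (meson openE)
    have *: "\<alpha> < s \<and> \<gamma> s x \<noteq> 0" if s: "s \<in> ball \<tau> \<delta>" and x: "x \<in> {0..2*pi}" for s x
    proof
      have sU: "s \<in> U \<inter> {\<alpha><..}" using s d(2) by blast
      then show "\<alpha> < s" by simp
      have "dist (f (s, x)) (f (\<tau>, x)) \<le> norm (\<gamma> \<tau> x0) / 2" using U(3) sU x by blast
      then have "dist (\<gamma> s x) (\<gamma> \<tau> x) \<le> norm (\<gamma> \<tau> x0) / 2" by (simp add: f_def)
      moreover have "0 < norm (\<gamma> \<tau> x0)" using assms(5) by simp
      moreover have "norm (\<gamma> \<tau> x) = dist (\<gamma> s x) (\<gamma> \<tau> x)" if "\<gamma> s x = 0" using that by simp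
      ultimately show "\<gamma> s x \<noteq> 0" using x0[OF x] by linarith
    qed
    show thesis by (rule that[OF d(1) *])
  qed
  let ?B = "ball \<tau> \<delta>"
  have at_B: "at \<tau> within ?B = at \<tau>"
    by (rule at_within_open[OF _ open_ball]) (use \<delta>(1) in simp)
  have sub: "?B \<times> {0..2*pi} \<subseteq> dom" using \<delta>(2) by (force simp: dom_def)
  have "((\<lambda>s. integral (cbox 0 (2*pi)) (\<lambda>x. F_fun lam (\<gamma> s x) (fx (s, x)))) has_field_derivative
      integral (cbox 0 (2*pi)) (\<lambda>x. dF lam (\<gamma> \<tau> x) (fx (\<tau>, x)) (fs (\<tau>, x)) (fxs (\<tau>, x)))) (at \<tau> within ?B)"
  proof (rule leibniz_rule_field_derivative[where f = "\<lambda>s x. F_fun lam (\<gamma> s x) (fx (s, x))"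
        and fx = "\<lambda>s x. dF lam (\<gamma> s x) (fx (s, x)) (fs (s, x)) (fxs (s, x))"])
    fix s x assume s: "s \<in> ?B" and x: "x \<in> cbox 0 (2*pi)"
    have s\<alpha>: "\<alpha> < s" and \<gamma>0: "\<gamma> s x \<noteq> 0" using \<delta>(2)[OF s, of x] x by auto
    have "fx (s, x) \<noteq> 0" using reg[OF s\<alpha>, of x] by (simp add: cd[OF s\<alpha>])
    then have "((\<lambda>s. F_fun lam (\<gamma> s x) (fx (s, x))) has_real_derivative
        dF lam (\<gamma> s x) (fx (s, x)) (fs (s, x)) (fxs (s, x))) (at s)"
      by (rule F_fun_has_derivative_along[OF lam ds[OF s\<alpha>, of x] dxs[OF s\<alpha>, of x] \<gamma>0])
    then show "((\<lambda>s. F_fun lam (\<gamma> s x) (fx (s, x))) has_field_derivative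
        dF lam (\<gamma> s x) (fx (s, x)) (fs (s, x)) (fxs (s, x))) (at s within ?B)"
      by (rule has_field_derivative_at_within)
  next
    fix s assume s: "s \<in> ?B"
    have s\<alpha>: "\<alpha> < s" using \<delta>(2)[OF s, of 0] by auto
    have "fx (s, x) \<noteq> 0" for x using reg[OF s\<alpha>, of x] by (simp add: cd[OF s\<alpha>])
    moreover have "continuous_on (cbox 0 (2*pi)) (\<gamma> s)" "continuous_on (cbox 0 (2*pi)) (\<lambda>x. fx (s, x))"
      using continuous_on_subset[OF slice[OF cont(1) s\<alpha>] subset_UNIV]
        continuous_on_subset[OF slice[OF cont(2) s\<alpha>] subset_UNIV] by (simp_all add: f_def)
    ultimately show "(\<lambda>x. F_fun lam (\<gamma> s x) (fx (s, x))) integrable_on cbox 0 (2*pi)"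
      using \<delta>(2)[OF s] by (intro integrable_continuous continuous_on_F_fun[OF lam]) auto
  next
    have ne: "f p \<noteq> 0 \<and> fx p \<noteq> 0" if p: "p \<in> ?B \<times> cbox 0 (2*pi)" for p
    proof -
      obtain s x where sx: "p = (s, x)" "s \<in> ?B" "x \<in> {0..2*pi}" using p by auto
      then show ?thesis using \<delta>(2)[OF sx(2,3)] reg[of s x] by (simp add: cd f_def)
    qed
    have dFc: "continuous_on (?B \<times> cbox 0 (2*pi)) (\<lambda>p. dF lam (f p) (fx p) (fs p) (fxs p))"
      using ne continuous_on_subset[OF cont(1) sub] continuous_on_subset[OF cont(2) sub]
        continuous_on_subset[OF cont(5) sub] continuous_on_subset[OF cont(6) sub]
      by (intro continuous_on_dF lam) auto
    have "(\<lambda>p. dF lam (f p) (fx p) (fs p) (fxs p))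
        = (\<lambda>(s, x). dF lam (\<gamma> s x) (fx (s, x)) (fs (s, x)) (fxs (s, x)))"
      by (auto simp: f_def)
    then show "continuous_on (?B \<times> cbox 0 (2*pi)) (\<lambda>(s, x). dF lam (\<gamma> s x) (fx (s, x)) (fs (s, x)) (fxs (s, x)))"
      by (rule subst) (rule dFc)
  next
    show "\<tau> \<in> ?B" using \<delta>(1) by simp
    show "convex ?B" by (rule convex_ball)
  qed
  then have der: "((\<lambda>s. integral {0..2*pi} (\<lambda>x. F_fun lam (\<gamma> s x) (fx (s, x)))) has_real_derivative
      - integral {0..2*pi} (normal_term lam (\<gamma> \<tau>) \<nu>) - integral {0..2*pi} (binormal_term lam (\<gamma> \<tau>) \<nu>)) (at \<tau>)"
    unfolding at_B cbox_interval first_variation_integral .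
  have "\<forall>\<^sub>F s in nhds \<tau>. \<alpha> < s"
    using eventually_nhds_in_open[OF open_greaterThan, of \<tau> \<alpha>] \<tau> by simp
  then have "\<forall>\<^sub>F s in nhds \<tau>. integral {0..2*pi} (\<lambda>x. F_fun lam (\<gamma> s x) (curve_d (\<gamma> s) x))
      = integral {0..2*pi} (\<lambda>x. F_fun lam (\<gamma> s x) (fx (s, x)))"
    by (rule eventually_mono) (simp only: cd)
  from DERIV_cong_ev[OF refl this refl] der
  have "((\<lambda>s. integral {0..2*pi} (\<lambda>x. F_fun lam (\<gamma> s x) (curve_d (\<gamma> s) x))) has_real_derivative
      - integral {0..2*pi} (normal_term lam (\<gamma> \<tau>) \<nu>) - integral {0..2*pi} (binormal_term lam (\<gamma> \<tau>) \<nu>)) (at \<tau>)"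
    by (rule iffD2)
  moreover have "(\<lambda>x. F_fun lam (\<gamma> \<tau> x) (curve_d (\<gamma> \<tau>) x)) absolutely_integrable_on {0..2*pi}"
    unfolding cd[OF \<tau>] by (rule F_absolutely_integrable)
  ultimately show ?thesis
    by (intro conjI terms_integrable)
qed

end
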